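(* Let $A$ be a simple unital C*-algebra with real rank zero, and suppose that the order on projections over $A$ is determined by traces. Let $\alpha\in\mathrm{Aut}(A)$ have the tracial Rokhlin property. Then the restriction map $\tau\mapsto\tau|_A$ is a bijection from the set of tracial states of $C^*(\mathbb{Z},A,\alpha)$ to the set of $\alpha$-invariant tracial states of $A$.
   Context: $T(A)$ is the set of tracial states of a unital C*-algebra $A$; each $\tau\in T(A)$ is extended (unnormalized, i.e. as $\mathrm{Tr}\otimes\tau$) to $M_\infty(A)=\bigcup_{n\ge 1}M_n(A)$. $p\precsim q$ means $p$ is Murray-von Neumann equivalent to a subprojection of $q$. "The order on projections over $A$ is determined by traces" means: whenever $p,q\in M_\infty(A)$ are projections with $\tau(p)<\tau(q)$ for all $\tau\in T(A)$, then $p\precsim q$ (in $M_\infty(A)$). Tracial Rokhlin property (this property is defined for $A$ a stably finite simple unital C*-algebra): $\alpha\in\mathrm{Aut}(A)$ has it if for every finite set $F\subset A$, every $\varepsilon>0$, every $n\in\mathbb{N}$, and every nonzero positive $x\in A$, there are mutually orthogonal projections $e_0,e_1,\dots,e_n\in A$ such that: (1) $\|\alpha(e_j)-e_{j+1}\|<\varepsilon$ for $0\le j\le n-1$; (2) $\|e_ja-ae_j\|<\varepsilon$ for $0\le j\le n$ and all $a\in F$; (3) with $e=\sum_{j=0}^n e_j$, the projection $1-e$ is Murray-von Neumann equivalent to a projection in the hereditary subalgebra $\overline{xAx}$ of $A$ generated by $x$. Real rank zero: the invertible selfadjoint elements are dense in the selfadjoint elements. $C^*(\mathbb{Z},A,\alpha)$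 is the crossed product of $A$ by the action of $\mathbb{Z}$ generated by $\alpha$, and $A$ is regarded as a subalgebra of it in the usual way.
   Formalization: The formal theorem additionally assumes that A is not one-dimensional (A ≠ ℂ); for A = ℂ with the identity automorphism the tracial Rokhlin property holds as defined, but C*(ℤ,A,α) = C(S¹) has many tracial states, so the claim fails. *)

theory Defs
  imports "HOL-Analysis.Analysis"
begin

section \<open>Unital C*-algebras\<close>

(* real_normed_algebra_1 contains norm 1 = 1, so the zero algebra is excluded. *)
class unital_cstar_algebra = real_normed_algebra_1 + banach +
  fixes scaleC :: "complex \<Rightarrow> 'a \<Rightarrow> 'a"  (infixr "*\<^sub>C" 75)
    and star :: "'a \<Rightarrow> 'a"
  assumes scaleC_add_right: "c *\<^sub>C (x + y) = c *\<^sub>C x + c *\<^sub>C y"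
    and scaleC_add_left: "(c + d) *\<^sub>C x = c *\<^sub>C x + d *\<^sub>C x"
    and scaleC_scaleC: "c *\<^sub>C d *\<^sub>C x = (c * d) *\<^sub>C x"
    and scaleR_scaleC: "r *\<^sub>R x = complex_of_real r *\<^sub>C x"
    and mult_scaleC_left: "(c *\<^sub>C x) * y = c *\<^sub>C (x * y)"
    and mult_scaleC_right: "x * (c *\<^sub>C y) = c *\<^sub>C (x * y)"
    and norm_scaleC: "norm (c *\<^sub>C x) = cmod c * norm x"
    and star_add: "star (x + y) = star x + star y"
    and star_scaleC: "star (c *\<^sub>C x) = cnj c *\<^sub>C star x"
    and star_mult: "star (x * y) = star y * star x"
    and star_star: "star (star x) = x"
    and cstar_identity: "norm (star x * x) = (norm x)\<^sup>2"

definition selfadjoint :: "'a::unital_cstar_algebra \<Rightarrow> bool" where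
  "selfadjoint x \<longleftrightarrow> star x = x"

definition positive :: "'a::unital_cstar_algebra \<Rightarrow> bool" where
  "positive x \<longleftrightarrow> (\<exists>a. x = star a * a)"

definition projection :: "'a::unital_cstar_algebra \<Rightarrow> bool" where
  "projection p \<longleftrightarrow> star p = p \<and> p * p = p"

definition unitary :: "'a::unital_cstar_algebra \<Rightarrow> bool" where
  "unitary u \<longleftrightarrow> star u * u = 1 \<and> u * star u = 1"

definition invertible_elt :: "'a::unital_cstar_algebra \<Rightarrow> bool" where
  "invertible_elt x \<longleftrightarrow> (\<exists>y. x * y = 1 \<and> y * x = 1)"

definition mvn_equiv :: "'a::unital_cstar_algebra \<Rightarrow> 'a \<Rightarrow> bool" where
  "mvn_equiv p q \<longleftrightarrow> (\<exists>v. star v * v = p \<and> v * star v = q)"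

definition star_hom :: "('a::unital_cstar_algebra \<Rightarrow> 'b::unital_cstar_algebra) \<Rightarrow> bool" where
  "star_hom f \<longleftrightarrow>
     (\<forall>x y. f (x + y) = f x + f y) \<and> (\<forall>c x. f (c *\<^sub>C x) = c *\<^sub>C f x) \<and>
     (\<forall>x y. f (x * y) = f x * f y) \<and> (\<forall>x. f (star x) = star (f x)) \<and> f 1 = 1"

definition star_automorphism :: "('a::unital_cstar_algebra \<Rightarrow> 'a) \<Rightarrow> bool" where
  "star_automorphism \<alpha> \<longleftrightarrow> star_hom \<alpha> \<and> bij \<alpha>"

definition tracial_states :: "('a::unital_cstar_algebra \<Rightarrow> complex) set" where
  "tracial_states = {\<tau>.
     (\<forall>x y. \<tau> (x + y) = \<tau> x + \<tau> y) \<and> (\<forall>c x. \<tau> (c *\<^sub>C x) = c * \<tau> x) \<and>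
     (\<forall>x. positive x \<longrightarrow> \<tau> x \<in> \<real>\<^sub>\<ge>\<^sub>0) \<and> \<tau> 1 = 1 \<and> (\<forall>x y. \<tau> (x * y) = \<tau> (y * x))}"

definition closed_ideal :: "'a::unital_cstar_algebra set \<Rightarrow> bool" where
  "closed_ideal I \<longleftrightarrow> closed I \<and> 0 \<in> I \<and> (\<forall>x\<in>I. \<forall>y\<in>I. x + y \<in> I) \<and>
     (\<forall>x\<in>I. \<forall>c. c *\<^sub>C x \<in> I) \<and> (\<forall>x\<in>I. \<forall>a. a * x \<in> I \<and> x * a \<in> I)"

definition simple_algebra :: "'a::unital_cstar_algebra itself \<Rightarrow> bool" where
  "simple_algebra _ \<longleftrightarrow> (\<forall>I::'a set. closed_ideal I \<longrightarrow> I = {0} \<or> I = UNIV)"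

definition real_rank_zero :: "'a::unital_cstar_algebra itself \<Rightarrow> bool" where
  "real_rank_zero _ \<longleftrightarrow>
     {x::'a. selfadjoint x} \<subseteq> closure {x. selfadjoint x \<and> invertible_elt x}"

(* The algebra of complex numbers must be excluded from the theorem: over it, the identity
   automorphism has the tracial Rokhlin property in the sense below (take all e j to be 0), but its
   crossed product is C(S^1), which has many tracial states. *)
definition one_dimensional :: "'a::unital_cstar_algebra itself \<Rightarrow> bool" where
  "one_dimensional _ \<longleftrightarrow> (\<forall>a::'a. \<exists>c. a = c *\<^sub>C 1)"

section \<open>Matrices\<close>

(* M_n(A) is the set of infinite matrices supported in the upper left n by n corner, so that
   the embedding of M_n(A) in M_{n+1}(A) is an inclusion. *)
type_synonym 'a imat = "nat \<Rightarrow> nat \<Rightarrow> 'a"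

definition mat_n :: "nat \<Rightarrow> 'a::unital_cstar_algebra imat set" where
  "mat_n n = {P. \<forall>i j. n \<le> i \<or> n \<le> j \<longrightarrow> P i j = 0}"

definition mat_inf :: "'a::unital_cstar_algebra imat set" where
  "mat_inf = (\<Union>n\<in>{1..}. mat_n n)"

definition mat_one :: "nat \<Rightarrow> 'a::unital_cstar_algebra imat" where
  "mat_one n = (\<lambda>i j. if i = j \<and> i < n then 1 else 0)"

definition mat_mult :: "'a::unital_cstar_algebra imat \<Rightarrow> 'a imat \<Rightarrow> 'a imat" where
  "mat_mult P Q = (\<lambda>i k. \<Sum>j | P i j \<noteq> 0. P i j * Q j k)"

definition mat_star :: "'a::unital_cstar_algebra imat \<Rightarrow> 'a imat" where
  "mat_star P = (\<lambda>i j. star (P j i))"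

definition mat_trace :: "('a::unital_cstar_algebra \<Rightarrow> complex) \<Rightarrow> 'a imat \<Rightarrow> complex" where
  "mat_trace \<tau> P = (\<Sum>i | P i i \<noteq> 0. \<tau> (P i i))"

definition mat_projection :: "'a::unital_cstar_algebra imat \<Rightarrow> bool" where
  "mat_projection P \<longleftrightarrow> P \<in> mat_inf \<and> mat_star P = P \<and> mat_mult P P = P"

definition mat_mvn_equiv :: "'a::unital_cstar_algebra imat \<Rightarrow> 'a imat \<Rightarrow> bool" where
  "mat_mvn_equiv P Q \<longleftrightarrow>
     (\<exists>V\<in>mat_inf. mat_mult (mat_star V) V = P \<and> mat_mult V (mat_star V) = Q)"

definition mat_subprojection :: "'a::unital_cstar_algebra imat \<Rightarrow> 'a imat \<Rightarrow> bool" where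
  "mat_subprojection R Q \<longleftrightarrow> mat_projection R \<and> mat_mult Q R = R"

definition mat_precsim :: "'a::unital_cstar_algebra imat \<Rightarrow> 'a imat \<Rightarrow> bool" where
  "mat_precsim P Q \<longleftrightarrow> (\<exists>R. mat_subprojection R Q \<and> mat_mvn_equiv P R)"

(* M_n(A) is finite when its unit is not equivalent to a proper subprojection of itself. *)
definition stably_finite :: "'a::unital_cstar_algebra itself \<Rightarrow> bool" where
  "stably_finite _ \<longleftrightarrow> (\<forall>n\<ge>1. \<forall>R::'a imat.
     mat_subprojection R (mat_one n) \<and> mat_mvn_equiv (mat_one n) R \<longrightarrow> R = mat_one n)"

(* Traces of projections are real, so comparing real parts loses nothing. *)
definition order_determined_by_traces :: "'a::unital_cstar_algebra itself \<Rightarrow> bool" where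
  "order_determined_by_traces _ \<longleftrightarrow> (\<forall>P Q::'a imat.
     mat_projection P \<and> mat_projection Q \<and>
     (\<forall>\<tau>\<in>tracial_states. Re (mat_trace \<tau> P) < Re (mat_trace \<tau> Q)) \<longrightarrow> mat_precsim P Q)"

section \<open>The tracial Rokhlin property\<close>

definition hereditary_subalgebra :: "'a::unital_cstar_algebra \<Rightarrow> 'a set" where
  "hereditary_subalgebra x = closure {x * a * x | a. True}"

definition tracial_rokhlin_property :: "('a::unital_cstar_algebra \<Rightarrow> 'a) \<Rightarrow> bool" where
  "tracial_rokhlin_property \<alpha> \<longleftrightarrow>
     (\<forall>F::'a set. \<forall>\<epsilon>::real. \<forall>n::nat. \<forall>x::'a. finite F \<and> \<epsilon> > 0 \<and> positive x \<and> x \<noteq> 0 \<longrightarrow>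
       (\<exists>e::nat \<Rightarrow> 'a.
          (\<forall>j\<le>n. projection (e j)) \<and>
          (\<forall>i\<le>n. \<forall>j\<le>n. i \<noteq> j \<longrightarrow> e i * e j = 0) \<and>
          (\<forall>j<n. norm (\<alpha> (e j) - e (j + 1)) < \<epsilon>) \<and>
          (\<forall>j\<le>n. \<forall>a\<in>F. norm (e j * a - a * e j) < \<epsilon>) \<and>
          (\<exists>q\<in>hereditary_subalgebra x. projection q \<and> mvn_equiv (1 - (\<Sum>j\<le>n. e j)) q)))"

section \<open>Crossed products by the integers\<close>

definition aut_pow :: "('a \<Rightarrow> 'a) \<Rightarrow> int \<Rightarrow> 'a \<Rightarrow> 'a" where
  "aut_pow \<alpha> k = (if 0 \<le> k then \<alpha> ^^ nat k else inv \<alpha> ^^ nat (- k))"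

definition unitary_pow :: "'a::unital_cstar_algebra \<Rightarrow> int \<Rightarrow> 'a" where
  "unitary_pow u k = (if 0 \<le> k then u ^ nat k else star u ^ nat (- k))"

(* The algebraic crossed product consists of the finitely supported functions on the integers,
   f standing for the formal sum of the f n u^n. Its product and involution are dictated by
   (a u^k) (b u^l) = a (alpha^k b) u^(k+l)  and  (a u^k)^* = alpha^(-k) (a^* ) u^(-k). *)
definition finsupp :: "(int \<Rightarrow> 'a::unital_cstar_algebra) set" where
  "finsupp = {f. finite {n. f n \<noteq> 0}}"

definition conv :: "('a::unital_cstar_algebra \<Rightarrow> 'a) \<Rightarrow> (int \<Rightarrow> 'a) \<Rightarrow> (int \<Rightarrow> 'a) \<Rightarrow> int \<Rightarrow> 'a" where
  "conv \<alpha> f g = (\<lambda>n. \<Sum>k | f k \<noteq> 0. f k * aut_pow \<alpha> k (g (n - k)))"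

definition conv_star :: "('a::unital_cstar_algebra \<Rightarrow> 'a) \<Rightarrow> (int \<Rightarrow> 'a) \<Rightarrow> int \<Rightarrow> 'a" where
  "conv_star \<alpha> f = (\<lambda>n. aut_pow \<alpha> n (star (f (- n))))"

definition cstar_seminorm ::
    "('a::unital_cstar_algebra \<Rightarrow> 'a) \<Rightarrow> ((int \<Rightarrow> 'a) \<Rightarrow> real) \<Rightarrow> bool" where
  "cstar_seminorm \<alpha> N \<longleftrightarrow>
     (\<forall>f\<in>finsupp. 0 \<le> N f) \<and>
     (\<forall>f\<in>finsupp. \<forall>g\<in>finsupp. N (\<lambda>n. f n + g n) \<le> N f + N g) \<and>
     (\<forall>f\<in>finsupp. \<forall>c. N (\<lambda>n. c *\<^sub>C f n) = cmod c * N f) \<and>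
     (\<forall>f\<in>finsupp. \<forall>g\<in>finsupp. N (conv \<alpha> f g) \<le> N f * N g) \<and>
     (\<forall>f\<in>finsupp. N (conv \<alpha> (conv_star \<alpha> f) f) = (N f)\<^sup>2)"

definition integrated_form ::
    "('a::unital_cstar_algebra \<Rightarrow> 'b::unital_cstar_algebra) \<Rightarrow> 'b \<Rightarrow> (int \<Rightarrow> 'a) \<Rightarrow> 'b" where
  "integrated_form \<iota> u f = (\<Sum>n | f n \<noteq> 0. \<iota> (f n) * unitary_pow u n)"

(* The algebra 'b, with the canonical map \<iota> from 'a and the canonical unitary u, is the
   (full) crossed product: the completion of the algebraic crossed product in its largest
   C*-seminorm. For a covariant pair (\<iota>, u), the norm of the integrated form is itself a
   C*-seminorm, so the last clause identifies it as the largest one. It is the universal property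
   of C*(Z, A, alpha), because covariant pairs in other C*-algebras (which live on other types
   and cannot be quantified over) induce C*-seminorms on the algebraic crossed product, and every
   C*-seminorm arises in this way. *)
definition is_crossed_product ::
    "('a::unital_cstar_algebra \<Rightarrow> 'a) \<Rightarrow> ('a \<Rightarrow> 'b::unital_cstar_algebra) \<Rightarrow> 'b \<Rightarrow> bool" where
  "is_crossed_product \<alpha> \<iota> u \<longleftrightarrow>
     star_hom \<iota> \<and> unitary u \<and> (\<forall>a. u * \<iota> a * star u = \<iota> (\<alpha> a)) \<and>
     closure (integrated_form \<iota> u ` finsupp) = UNIV \<and>
     (\<forall>N. cstar_seminorm \<alpha> N \<longrightarrow> (\<forall>f\<in>finsupp. N f \<le> norm (integrated_form \<iota> u f)))"

end

theory Submission imports Defs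
begin

text \<open>
  Injectivity: for a tracial state \<open>\<sigma>\<close> on the crossed product and \<open>n \<noteq> 0\<close>, a Rokhlin tower
  \<open>e\<^sub>0, \<dots>, e\<^sub>N\<close> almost commuting with \<open>a\<close> gives
  \<open>\<sigma> (a u\<^sup>n) \<approx> \<Sum>j. \<sigma> (e\<^sub>j a u\<^sup>n e\<^sub>j) \<approx> \<Sum>j. \<sigma> (a e\<^sub>j e\<^bsub>j+n\<^esub> u\<^sup>n) = 0\<close>,
  up to the \<open>n\<close> top levels and the remainder \<open>1 - \<Sum>j. e\<^sub>j\<close>, all of which have small trace. Hence
  \<open>\<sigma>\<close> is determined by its restriction. The remainder is made small by applying the Rokhlin property
  below a projection of small trace, and such a projection is itself a level of a long tower
  whose remainder lies below a noninvertible element: by finiteness that tower is not zero, and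
  then none of its levels is.

  Surjectivity: an invariant trace \<open>\<tau>\<close> defines a representation of the algebraic crossed product by left
  multiplication on the pre-Hilbert space of finitely supported functions. Its operator norm is a
  C*-seminorm bounding \<open>\<bar>\<tau> (f 0)\<bar>\<close>, so \<open>f \<mapsto> \<tau> (f 0)\<close> is bounded in the norm of the crossed
  product and extends by continuity.
\<close>

section \<open>The involution and homomorphisms\<close>

text \<open>The estimates are made in the seminorm \<open>trace_norm\<close>, because the discarded
  parts of a tower, its remainder and its top levels, are projections: their operator norm is 1
  unless they vanish, but the square root of their trace is small. Cauchy-Schwarz turns this into a
  bound for the trace of a coefficient times a power of u, which has norm 1. The order of choices
  matters: first the length N of the tower, then the tolerance, in terms of N, and the projection of
  small trace; the n top levels then cost only a term of order 1 / sqrt N. No order on selfadjoint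
  elements is introduced: an inequality x \<le> y is replaced by a selfadjoint square root of y - x,
  given by the binomial series. Noninvertibility is likewise derived from explicit roots and
  inverses instead of a spectrum. In the surjectivity half nothing is completed: the semi-inner
  product on finitely supported functions may be degenerate, and only an operator seminorm is
  extracted from it, which is what maximality of the crossed product norm can be applied to.\<close>

lemma scaleC_zero_left [simp]: "0 *\<^sub>C (x::'a::unital_cstar_algebra) = 0"
  using scaleR_scaleC[of 0 x] by simp

lemma scaleC_zero_right [simp]: "c *\<^sub>C (0::'a::unital_cstar_algebra) = 0"
  using scaleC_add_right[of c 0 "0::'a"] by simp

lemma scaleC_one [simp]: "1 *\<^sub>C (x::'a::unital_cstar_algebra) = x"
  using scaleR_scaleC[of 1 x] by simp

lemma scaleC_minus_right: "c *\<^sub>C (- x) = - (c *\<^sub>C (x::'a::unital_cstar_algebra))"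
  using scaleC_add_right[of c x "- x"] by (simp add: eq_neg_iff_add_eq_0 add.commute)

lemma scaleC_minus_left: "(- c) *\<^sub>C x = - (c *\<^sub>C (x::'a::unital_cstar_algebra))"
  using scaleC_add_left[of c "- c" x] by (simp add: eq_neg_iff_add_eq_0 add.commute)

lemma scaleC_diff_right: "c *\<^sub>C (x - y) = c *\<^sub>C x - c *\<^sub>C (y::'a::unital_cstar_algebra)"
  using scaleC_add_right[of c x "- y"] by (simp add: scaleC_minus_right)

lemma scaleC_sum_right: "c *\<^sub>C (\<Sum>i\<in>I. f i) = (\<Sum>i\<in>I. c *\<^sub>C (f i :: 'a::unital_cstar_algebra))"
  by (induction I rule: infinite_finite_induct) (auto simp: scaleC_add_right)

lemma minus_scaleC: "- x = (-1) *\<^sub>C (x::'a::unital_cstar_algebra)"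
  using scaleR_scaleC[of "-1" x] by simp

lemma star_zero [simp]: "star (0::'a::unital_cstar_algebra) = 0"
  using star_add[of 0 "0::'a"] by simp

lemma star_one [simp]: "star (1::'a::unital_cstar_algebra) = 1"
  by (metis mult_1 mult.right_neutral star_mult star_star)

lemma star_minus: "star (- x) = - star (x::'a::unital_cstar_algebra)"
  using star_add[of x "- x"] by (simp add: eq_neg_iff_add_eq_0 add.commute)

lemma star_diff: "star (x - y) = star x - star (y::'a::unital_cstar_algebra)"
  using star_add[of x "- y"] by (simp add: star_minus)

lemma star_scaleR: "star (r *\<^sub>R x) = r *\<^sub>R star (x::'a::unital_cstar_algebra)"
  by (simp add: scaleR_scaleC star_scaleC)

lemma star_sum: "star (\<Sum>i\<in>I. f i) = (\<Sum>i\<in>I. star (f i :: 'a::unital_cstar_algebra))"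
  by (induction I rule: infinite_finite_induct) (auto simp: star_add)

lemma star_power: "star (x ^ n) = star (x::'a::unital_cstar_algebra) ^ n"
  by (induction n) (auto simp: star_mult power_commutes)

lemma star_eq_0_iff [simp]: "star x = 0 \<longleftrightarrow> (x::'a::unital_cstar_algebra) = 0"
  by (metis star_star star_zero)

text \<open>The C*-identity with submultiplicativity gives \<open>norm y\<close> \<le>
  \<open>norm (star y)\<close>; applied to \<open>star x\<close> it gives the reverse.\<close>

lemma norm_star [simp]: "norm (star x) = norm (x::'a::unital_cstar_algebra)"
proof -
  have le: "norm y \<le> norm (star y)" for y :: 'a
  proof (cases "y = 0")
    case False
    have "norm y * norm y \<le> norm (star y) * norm y"
      using cstar_identity[of y] norm_mult_ineq[of "star y" y] by (simp add: power2_eq_square)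
    then show ?thesis using False by simp
  qed simp
  show ?thesis using le[of x] le[of "star x"] by (simp add: star_star)
qed

lemma bounded_linear_star: "bounded_linear (star :: 'a::unital_cstar_algebra \<Rightarrow> 'a)"
  by (rule bounded_linear_intro[of _ 1]) (auto simp: star_add star_scaleR)

lemma positive_selfadjoint_square:
  fixes s :: "'a::unital_cstar_algebra"
  shows "star s = s \<Longrightarrow> positive (s * s)"
  unfolding positive_def by metis

lemma star_hom_simps:
  assumes "star_hom f"
  shows "f (x + y) = f x + f y" "f (c *\<^sub>C x) = c *\<^sub>C f x" "f (x * y) = f x * f y"
    "f (star x) = star (f x)" "f 1 = 1"
  using assms unfolding star_hom_def by auto

lemma star_hom_zero: "star_hom f \<Longrightarrow> f 0 = 0"
  by (metis add_cancel_right_left star_hom_simps(1))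

lemma star_hom_minus: "star_hom f \<Longrightarrow> f (- x) = - f x"
  by (metis minus_scaleC star_hom_simps(2))

lemma star_hom_diff: "star_hom f \<Longrightarrow> f (x - y) = f x - f y"
  by (metis add_uminus_conv_diff star_hom_minus star_hom_simps(1))

lemma star_hom_sum: "star_hom f \<Longrightarrow> f (\<Sum>i\<in>I. g i) = (\<Sum>i\<in>I. f (g i))"
  by (induction I rule: infinite_finite_induct) (auto simp: star_hom_zero star_hom_simps(1))

section \<open>Square roots near the unit\<close>

lemma mult_sums_commute:
  fixes x :: "'a::real_normed_algebra"
  assumes "f sums s" "\<And>n. x * f n = f n * x"
  shows "x * s = s * x"
proof (rule sums_unique2)
  show "(\<lambda>n. x * f n) sums (x * s)" by (rule sums_mult) fact
  show "(\<lambda>n. x * f n) sums (s * x)" using sums_mult2[OF assms(1), of x] assms(2) by simp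
qed

text \<open>With \<open>d n\<close> the coefficients of (1 - t)^(1/2), all but \<open>d 0\<close> =
  1 are nonpositive, while the partial sums have a closed form that is nonnegative. Hence the
  absolute values beyond \<open>d 0\<close> add up to at most 1. Absolute convergence at radius
  exactly 1 is what permits \<open>norm k\<close> = 1 in \<open>sqrt_one_minus\<close>.\<close>

lemma summable_norm_half_gbinomial: "summable (\<lambda>n. norm ((1/2::real) gchoose n))"
proof -
  define d where "d n = ((1/2::real) gchoose n) * (-1) ^ n" for n
  have d: "d n = pochhammer (-1/2) n / fact n" for n
    by (simp add: d_def gbinomial_pochhammer power_mult_distrib[symmetric])
  have nonpos: "d (Suc n) \<le> 0" for n
    using pochhammer_nonneg[of "1/2::real" n]
    by (simp add: d pochhammer_rec divide_nonpos_pos)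
  have "(\<Sum>n<m. norm (d (Suc n))) \<le> 1" for m
  proof -
    have "0 \<le> pochhammer (1/2::real) m / fact m"
      using pochhammer_nonneg[of "1/2::real" m] by simp
    also have "\<dots> = (\<Sum>n\<le>m. d n)"
      unfolding d_def gbinomial_sum_lower_neg
      by (simp add: gbinomial_pochhammer power_mult_distrib[symmetric])
    also have "\<dots> = 1 - (\<Sum>n<m. norm (d (Suc n)))"
      using nonpos by (simp add: sum.atMost_shift sum_negf[symmetric] d[of 0] abs_of_nonpos)
    finally show ?thesis by simp
  qed
  then have "summable (\<lambda>n. norm (d (Suc n)))" by (intro summableI_nonneg_bounded) auto
  then show ?thesis by (subst (asm) summable_Suc_iff) (simp add: d_def abs_mult)
qed

text \<open>The root is the binomial series in \<open>- k\<close>. The commutation clause later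
  allows roots of commuting elements to be multiplied to a selfadjoint root of the product.\<close>

lemma sqrt_one_minus:
  fixes k :: "'a::unital_cstar_algebra"
  assumes k: "norm k \<le> 1" and sa: "star k = k"
  obtains s where "star s = s" "s * s = 1 - k" "\<And>x. x * k = k * x \<Longrightarrow> x * s = s * x"
proof -
  define c where "c n = ((1/2::real) gchoose n)" for n
  define f where "f n = c n *\<^sub>R (- k) ^ n" for n
  have "norm ((- k) ^ n) \<le> 1" for n
    using norm_power_ineq[of "- k" n] k power_le_one[of "norm k" n] by simp
  then have "norm (f n) \<le> norm (c n)" for n
    by (simp add: f_def mult_left_le)
  then have sumn: "summable (\<lambda>n. norm (f n))"
    unfolding c_def
    by (intro summable_comparison_test'[OF summable_norm_half_gbinomial, of 0]) (simp only: real_norm_def abs_norm_cancel)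
  define s where "s = suminf f"
  have fs: "f sums s" unfolding s_def using sumn by (simp add: summable_norm_cancel summable_sums)
  have "star (f n) = f n" for n
    by (simp add: f_def star_scaleR star_power star_minus sa)
  then have "f sums star s" using bounded_linear.sums[OF bounded_linear_star fs] by simp
  then have 1: "star s = s" using fs sums_unique2 by blast
  have 3: "x * s = s * x" if "x * k = k * x" for x
  proof (rule mult_sums_commute[OF fs])
    fix n
    have "x * (- k) = (- k) * x" using that by simp
    then have "x * (- k) ^ n = (- k) ^ n * x" by (metis power_commuting_commutes)
    then show "x * f n = f n * x" by (simp add: f_def)
  qed
  have "(\<lambda>n. \<Sum>i\<le>n. f i * f (n - i)) sums (s * s)"
    unfolding s_def by (rule Cauchy_product_sums[OF sumn sumn])
  \<comment> \<open>Vandermonde with 1/2 + 1/2 = 1: the squared series is that of (1 - k)^1, so it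
    stops after degree 1.\<close>
  moreover have "(\<Sum>i\<le>n. f i * f (n - i)) = (if n \<in> {0,1} then (- k) ^ n else 0)" for n
  proof -
    have "(\<Sum>i\<le>n. f i * f (n - i)) = (\<Sum>i\<le>n. (c i * c (n - i)) *\<^sub>R (- k) ^ n)"
      by (intro sum.cong) (auto simp: f_def power_add[symmetric])
    also have "\<dots> = (1 gchoose n) *\<^sub>R (- k) ^ n"
      using gbinomial_Vandermonde[of "1/2::real" "1/2" n]
      by (simp add: scaleR_sum_left[symmetric] c_def atMost_atLeast0)
    also have "(1 gchoose n :: real) = (if n \<in> {0,1} then 1 else 0)"
      using binomial_gbinomial[of 1 n, where ?'a = real] by (auto simp: binomial_eq_0 not_less)
    finally show ?thesis by (auto split: if_splits)
  qed
  ultimately have "(\<lambda>n. if n \<in> {0,1} then (- k) ^ n else 0) sums (s * s)" by simp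
  moreover have "(\<lambda>n. if n \<in> {0,1} then (- k) ^ n else 0) sums (\<Sum>n\<in>{0,1}. (- k) ^ n)"
    by (rule sums_If_finite_set) simp
  ultimately have "s * s = 1 - k" using sums_unique2 by fastforce
  with 1 3 show ?thesis using that by blast
qed

text \<open>Stands for the operator inequality \<open>star x * x\<close> \<le> c: divide by c to
  reach norm at most 1, take the root, and scale it by \<open>sqrt c\<close>.\<close>

lemma positive_norm_minus:
  fixes x :: "'a::unital_cstar_algebra"
  assumes c: "(norm x)\<^sup>2 \<le> c" "0 < c"
  shows "\<exists>s. star s = s \<and> s * s = of_real c - star x * x"
proof -
  have c0: "c > 0" by fact
  have "norm ((1/c) *\<^sub>R (star x * x)) \<le> 1"
    using c c0 by (simp add: cstar_identity)
  moreover have "star ((1/c) *\<^sub>R (star x * x)) = (1/c) *\<^sub>R (star x * x)"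
    by (simp add: star_scaleR star_mult star_star)
  ultimately obtain s where s: "star s = s" "s * s = 1 - (1/c) *\<^sub>R (star x * x)"
    using sqrt_one_minus by blast
  define r where "r = sqrt c *\<^sub>R s"
  have "r * r = c *\<^sub>R (s * s)" using c0 by (simp add: r_def)
  also have "\<dots> = of_real c - star x * x"
    using c0 by (simp add: s scaleR_diff_right of_real_def)
  finally show ?thesis using s by (intro exI[of _ r]) (auto simp: r_def star_scaleR)
qed

section \<open>A nonzero noninvertible positive element\<close>

text \<open>The right-hand side is the squared norm of \<open>a + \<i>b\<close>.\<close>
lemma norm_le_sum_squares:
  fixes a b :: "'a::unital_cstar_algebra"
  assumes "star a = a" "star b = b" "a * b = b * a"
  shows "(norm a)\<^sup>2 \<le> norm (a * a + b * b)"
proof -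
  define c where "c = \<i> *\<^sub>C b"
  have c: "star c = - c" "c * c = - (b * b)" "c * a = a * c"
    by (simp_all add: c_def star_scaleC assms mult_scaleC_left mult_scaleC_right scaleC_scaleC
        scaleC_minus_left)
  define z where "z = a + c"
  have sz: "star z = a - c" by (simp add: z_def star_add c assms)
  have "star z * z = a * a + b * b"
    by (simp only: sz) (simp add: z_def algebra_simps c)
  \<comment> \<open>\<open>a\<close> is the real part of \<open>z\<close>, and \<open>star\<close>
    is isometric.\<close>
  moreover have "norm (a + a) \<le> norm z + norm (star z)"
    using norm_triangle_ineq[of z "star z"] by (simp only: sz) (simp add: z_def algebra_simps)
  then have "norm a \<le> norm z" by (simp flip: scaleR_2)
  then have "(norm a)\<^sup>2 \<le> (norm z)\<^sup>2" by simp
  ultimately show ?thesis by (simp add: cstar_identity[symmetric])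
qed

lemma invertible_elt_if_left_right:
  fixes x :: "'a::unital_cstar_algebra"
  assumes "x * r = 1" "l * x = 1"
  shows "invertible_elt x"
proof -
  have "l = l * (x * r)" by (simp add: assms(1))
  also have "\<dots> = r" by (simp add: assms(2) flip: mult.assoc)
  finally show ?thesis using assms unfolding invertible_elt_def by blast
qed

lemma invertible_eltD_commute:
  fixes x :: "'a::unital_cstar_algebra"
  assumes "x * y = 1" "y * x = 1" "x * z = z * x"
  shows "y * z = z * y"
proof -
  have "y * z = y * (z * x) * y" by (simp add: mult.assoc assms(1))
  also have "\<dots> = (y * x) * z * y" by (simp add: assms(3)[symmetric] mult.assoc)
  finally show ?thesis by (simp add: assms(2))
qed

text \<open>The inverse would give \<open>1 - h\<^sup>2 \<ge> \<delta>\<close> with \<open>\<delta> > 0\<close>, whence \<open>\<parallel>h\<parallel>\<^sup>2 \<le> 1 - \<delta>\<close>.\<close>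
lemma not_invertible_one_minus_square:
  fixes h :: "'a::unital_cstar_algebra"
  assumes sa: "star h = h" and nh: "norm h = 1"
  shows "\<not> invertible_elt (1 - h * h)"
proof
  assume "invertible_elt (1 - h * h)"
  then obtain g where g: "(1 - h * h) * g = 1" "g * (1 - h * h) = 1"
    unfolding invertible_elt_def by blast
  have hg: "g * h = h * g" by (rule invertible_eltD_commute[OF g]) (simp add: algebra_simps)
  have star_g: "star g = g"
  proof -
    have "star g * (1 - h * h) = 1"
      using arg_cong[OF g(1), of star] by (simp add: star_mult star_diff sa)
    then have "star g = star g * ((1 - h * h) * g)" by (simp add: g(1))
    also have "\<dots> = g" using \<open>star g * (1 - h * h) = 1\<close> by (simp add: mult.assoc[symmetric])
    finally show ?thesis .
  qed
  \<comment> \<open>Small enough that 1 - \<delta> g has a square root; the summand 1 keeps the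
    denominator positive and \<delta> at most 1.\<close>
  define \<delta> where "\<delta> = 1 / (1 + norm g)"
  have ng: "0 < 1 + norm g" by (simp add: add_pos_nonneg)
  have \<delta>: "0 < \<delta>" "\<delta> \<le> 1" by (simp_all add: \<delta>_def divide_le_eq ng)
  obtain s where s: "star s = s" "s * s = 1 - h * h" "\<And>x. x * (h * h) = h * h * x \<Longrightarrow> x * s = s * x"
  proof -
    have "norm (h * h) \<le> 1" "star (h * h) = h * h"
      using norm_mult_ineq[of h h] by (simp_all add: nh sa star_mult)
    from sqrt_one_minus[OF this] show ?thesis using that by blast
  qed
  obtain v where v: "star v = v" "v * v = 1 - \<delta> *\<^sub>R g"
      "\<And>x. x * (\<delta> *\<^sub>R g) = (\<delta> *\<^sub>R g) * x \<Longrightarrow> x * v = v * x"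
  proof -
    have "norm (\<delta> *\<^sub>R g) \<le> 1" "star (\<delta> *\<^sub>R g) = \<delta> *\<^sub>R g"
      using ng by (simp_all add: \<delta>_def star_scaleR star_g field_simps)
    from sqrt_one_minus[OF this] show ?thesis using that by blast
  qed
  have sh: "h * s = s * h" by (rule s(3)) (simp add: mult.assoc)
  have sg: "s * g = g * s"
    using s(3)[of g] hg by (metis mult.assoc)
  have vs: "v * s = s * v" "v * h = h * v" using v(3)[of s] v(3)[of h] sg hg by auto
  \<comment> \<open>\<open>w\<close> is a root of (1 - h h)(1 - \<delta> g), which is 1 - h h -
    \<delta> because \<open>g\<close> inverts the first factor.\<close>
  define w where "w = s * v"
  have "w * w = s * s * (v * v)" unfolding w_def by (metis vs(1) mult.assoc)
  also have "\<dots> = 1 - h * h - \<delta> *\<^sub>R 1"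
    using g(1) by (simp add: s(2) v(2) right_diff_distrib)
  finally have w: "w * w = 1 - h * h - \<delta> *\<^sub>R 1" .
  have "(norm h)\<^sup>2 \<le> norm (h * h + w * w)"
  proof (rule norm_le_sum_squares[OF sa])
    show "star w = w" by (simp add: w_def star_mult s(1) v(1) vs(1))
    show "h * w = w * h" unfolding w_def by (metis sh vs(2) mult.assoc)
  qed
  also have "h * h + w * w = (1 - \<delta>) *\<^sub>R 1" by (simp add: w scaleR_diff_left)
  finally show False using \<delta> nh by simp
qed

text \<open>A nonscalar selfadjoint h exists, since otherwise real and imaginary parts would make
  every element scalar; normalize it. If \<open>h * h\<close> differs from 1, then
  \<open>1 - h * h\<close> is noninvertible by the preceding lemma; if \<open>h * h\<close> = 1,
  then 1 + h is a nonzero zero divisor. Squaring makes either one positive and keeps it nonzero and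
  noninvertible.\<close>

lemma exists_noninvertible_positive:
  assumes "\<not> one_dimensional TYPE('a::unital_cstar_algebra)"
  shows "\<exists>x::'a. positive x \<and> x \<noteq> 0 \<and> \<not> invertible_elt x"
proof -
  have "\<exists>h::'a. star h = h \<and> (\<forall>c. h \<noteq> c *\<^sub>C 1)"
  proof (rule ccontr)
    assume "\<not> ?thesis"
    then have sc: "\<exists>c. h = c *\<^sub>C 1" if "star h = h" for h :: 'a using that by blast
    have "\<exists>c. a = c *\<^sub>C 1" for a :: 'a
    proof -
      have "star (a + star a) = a + star a" by (simp add: star_add star_star add.commute)
      then obtain c where c: "a + star a = c *\<^sub>C 1" using sc by blast
      have "star (\<i> *\<^sub>C (a - star a)) = \<i> *\<^sub>C (a - star a)"
        by (simp add: star_scaleC star_diff star_star scaleC_diff_right)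
          (simp add: scaleC_minus_left)
      then obtain d where "\<i> *\<^sub>C (a - star a) = d *\<^sub>C 1" using sc by blast
      then have "(- \<i>) *\<^sub>C \<i> *\<^sub>C (a - star a) = (- \<i>) *\<^sub>C d *\<^sub>C 1" by (rule arg_cong)
      then have d: "a - star a = (- \<i> * d) *\<^sub>C 1" by (simp add: scaleC_scaleC)
      have "(1/2) *\<^sub>C ((a + star a) + (a - star a)) = a"
        using scaleC_add_left[of "1/2" "1/2" a] by (simp add: scaleC_add_right scaleC_diff_right)
      then have "a = (1/2 * (c + - \<i> * d)) *\<^sub>C 1"
        unfolding c d by (simp only: scaleC_add_left[symmetric] scaleC_scaleC)
      then show ?thesis by blast
    qed
    then show False using assms unfolding one_dimensional_def by blast
  qed
  then obtain h' :: 'a where h': "star h' = h'" "\<And>c. h' \<noteq> c *\<^sub>C 1" by blast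
  have "h' \<noteq> 0" using h'(2)[of 0] by auto
  define h where "h = (1 / norm h') *\<^sub>R h'"
  have h: "star h = h" "norm h = 1" using \<open>h' \<noteq> 0\<close> h'(1) by (auto simp: h_def star_scaleR)
  have h_ns: "h \<noteq> r *\<^sub>R 1" for r
  proof
    assume "h = r *\<^sub>R 1"
    moreover have "h' = norm h' *\<^sub>R h" using \<open>h' \<noteq> 0\<close> by (simp add: h_def)
    ultimately have "h' = (norm h' * r) *\<^sub>R 1" by simp
    then show False using h'(2) by (metis scaleR_scaleC)
  qed
  define y where "y = 1 - h * h"
  have y: "star y = y" by (simp add: y_def star_diff star_mult h)
  show ?thesis
  proof (cases "y = 0")
    case True
    define z where "z = 1 + h"
    have z: "star z = z" by (simp add: z_def star_add h)
    have "z * (1 - h) = 0" using True by (simp add: z_def y_def algebra_simps)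
    moreover have "1 - h \<noteq> 0" using h_ns[of 1] by auto
    ultimately have "\<not> invertible_elt (z * z)"
      unfolding invertible_elt_def by (metis mult.assoc mult_1_left mult_zero_right)
    moreover have "z \<noteq> 0" using h_ns[of "-1"] by (auto simp: z_def eq_neg_iff_add_eq_0 add.commute)
    then have "z * z \<noteq> 0" using cstar_identity[of z] by (auto simp: z)
    ultimately show ?thesis using positive_selfadjoint_square[OF z] by blast
  next
    case False
    have "\<not> invertible_elt (y * y)"
    proof
      assume "invertible_elt (y * y)"
      then obtain g where "y * y * g = 1" "g * (y * y) = 1" unfolding invertible_elt_def by blast
      then have "y * (y * g) = 1" "(g * y) * y = 1" by (simp_all add: mult.assoc)
      then have "invertible_elt y" by (rule invertible_elt_if_left_right)
      then show False using not_invertible_one_minus_square[OF h] by (simp add: y_def)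
    qed
    moreover have "y * y \<noteq> 0" using cstar_identity[of y] False by (auto simp: y)
    ultimately show ?thesis using positive_selfadjoint_square[OF y] by blast
  qed
qed

section \<open>Tracial states and their 2-norms\<close>

lemma tracial_statesD:
  assumes "\<tau> \<in> tracial_states"
  shows "\<tau> (x + y) = \<tau> x + \<tau> y" "\<tau> (c *\<^sub>C x) = c * \<tau> x" "positive x \<Longrightarrow> \<tau> x \<in> \<real>\<^sub>\<ge>\<^sub>0"
    "\<tau> 1 = 1" "\<tau> (x * y) = \<tau> (y * x)"
  using assms unfolding tracial_states_def by auto

lemma tracial_state_zero: "\<tau> \<in> tracial_states \<Longrightarrow> \<tau> 0 = 0"
  using tracial_statesD(2)[of \<tau> 0 0] by simp

lemma tracial_state_minus: "\<tau> \<in> tracial_states \<Longrightarrow> \<tau> (- x) = - \<tau> x"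
  by (subst minus_scaleC) (simp add: tracial_statesD)

lemma tracial_state_diff: "\<tau> \<in> tracial_states \<Longrightarrow> \<tau> (x - y) = \<tau> x - \<tau> y"
  using tracial_statesD(1)[of \<tau> x "- y"] by (simp add: tracial_state_minus)

lemma tracial_state_scaleR: "\<tau> \<in> tracial_states \<Longrightarrow> \<tau> (r *\<^sub>R x) = of_real r * \<tau> x"
  by (simp add: scaleR_scaleC tracial_statesD)

lemma tracial_state_sum: "\<tau> \<in> tracial_states \<Longrightarrow> \<tau> (\<Sum>i\<in>I. f i) = (\<Sum>i\<in>I. \<tau> (f i))"
  by (induction I rule: infinite_finite_induct) (auto simp: tracial_state_zero tracial_statesD(1))

lemma tracial_state_square:
  assumes "\<tau> \<in> tracial_states"
  shows "0 \<le> Re (\<tau> (star x * x))" "Im (\<tau> (star x * x)) = 0"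
proof -
  have "\<tau> (star x * x) \<in> \<real>\<^sub>\<ge>\<^sub>0"
    using tracial_statesD(3)[OF assms, of "star x * x"] unfolding positive_def by blast
  then show "0 \<le> Re (\<tau> (star x * x))" "Im (\<tau> (star x * x)) = 0"
    by (auto simp: complex_nonneg_Reals_iff)
qed

text \<open>Polarization: the trace of \<open>star y * y\<close> is real, and taking y = x + c with
  c = 1 and c = \<i> gives the imaginary and the real component.\<close>

lemma tracial_state_star:
  assumes "\<tau> \<in> tracial_states"
  shows "\<tau> (star x) = cnj (\<tau> x)"
proof -
  note tr = tracial_statesD(1,2,4)[OF assms]
  have sq: "Im (\<tau> (star y * y)) = 0" for y using tracial_state_square[OF assms] by blast
  have "star (x + c *\<^sub>C 1) * (x + c *\<^sub>C 1) = star x * x + c *\<^sub>C star x + cnj c *\<^sub>C x + (cnj c * c) *\<^sub>C 1"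
    for c
    by (simp add: star_add star_scaleC distrib_left distrib_right mult_scaleC_left mult_scaleC_right
        scaleC_scaleC scaleC_add_right mult.commute add.assoc)
  then have "Im (\<tau> (star x * x) + c * \<tau> (star x) + cnj c * \<tau> x + cnj c * c) = 0" for c
    using sq[of "x + c *\<^sub>C 1"] by (simp only: tr mult_1_right)
  from this[of 1] this[of \<i>] sq[of x] show ?thesis by (simp add: complex_eq_iff)
qed

text \<open>The GNS seminorm of \<tau>; it vanishes on some nonzero elements when \<tau> is not
  faithful.\<close>

definition trace_norm :: "('a::unital_cstar_algebra \<Rightarrow> complex) \<Rightarrow> 'a \<Rightarrow> real" where
  "trace_norm \<tau> x = sqrt (Re (\<tau> (star x * x)))"

lemma trace_norm_nonneg [simp]: "\<tau> \<in> tracial_states \<Longrightarrow> 0 \<le> trace_norm \<tau> x"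
  by (simp add: trace_norm_def tracial_state_square)

lemma trace_norm_power2: "\<tau> \<in> tracial_states \<Longrightarrow> (trace_norm \<tau> x)\<^sup>2 = Re (\<tau> (star x * x))"
  by (simp add: trace_norm_def tracial_state_square)

lemma trace_norm_one: "\<tau> \<in> tracial_states \<Longrightarrow> trace_norm \<tau> 1 = 1"
  by (simp add: trace_norm_def tracial_statesD)

lemma trace_norm_star: "\<tau> \<in> tracial_states \<Longrightarrow> trace_norm \<tau> (star x) = trace_norm \<tau> x"
  by (simp add: trace_norm_def star_star tracial_statesD(5)[of \<tau> x "star x"])

text \<open>The discriminant step of Cauchy-Schwarz, with A and B the squared norms and T the
  squared modulus of the inner product. T appears in both terms because the phase is already built
  into the scalar.\<close>

lemma quadratic_nonneg_imp:
  fixes A B T :: real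
  assumes "0 \<le> B" "0 \<le> T" "\<And>r. 0 \<le> A - 2 * r * T + r\<^sup>2 * T * B"
  shows "T \<le> A * B"
proof (cases "B = 0")
  case True
  show ?thesis
  proof (cases "T = 0")
    case False
    \<comment> \<open>With B = 0 this value of r would make the form equal to -1.\<close>
    then show ?thesis using assms(3)[of "(A + 1) / (2 * T)"] assms(3)[of 0] True
      by (simp add: field_simps)
  qed (use True in simp)
next
  case False
  then have "0 < B" using assms(1) by simp
  \<comment> \<open>The form is minimal at r = 1 / B.\<close>
  then show ?thesis using assms(3)[of "1 / B"] by (simp add: field_simps power2_eq_square)
qed

lemma trace_Cauchy_Schwarz:
  assumes t: "\<tau> \<in> tracial_states"
  shows "cmod (\<tau> (star x * y)) \<le> trace_norm \<tau> x * trace_norm \<tau> y"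
proof -
  note tr = tracial_statesD(1,2)[OF t] tracial_state_diff[OF t]
  define T where "T = \<tau> (star x * y)"
  have yx: "\<tau> (star y * x) = cnj T"
    unfolding T_def using tracial_state_star[OF t, of "star x * y"] by (simp add: star_mult star_star)
  have "0 \<le> (trace_norm \<tau> x)\<^sup>2 - 2 * r * (cmod T)\<^sup>2 + r\<^sup>2 * (cmod T)\<^sup>2 * (trace_norm \<tau> y)\<^sup>2" for r
  proof -
    \<comment> \<open>The factor \<open>cnj T\<close> makes both cross terms the real number r times
      the squared modulus of T.\<close>
    define c where "c = of_real r * cnj T"
    have "star (x - c *\<^sub>C y) * (x - c *\<^sub>C y) =
      star x * x - c *\<^sub>C (star x * y) - cnj c *\<^sub>C (star y * x) + (cnj c * c) *\<^sub>C (star y * y)"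
      by (simp add: star_diff star_scaleC left_diff_distrib right_diff_distrib mult_scaleC_left
          mult_scaleC_right scaleC_scaleC scaleC_diff_right mult.commute)
    then have "\<tau> (star (x - c *\<^sub>C y) * (x - c *\<^sub>C y)) =
       \<tau> (star x * x) - c * T - cnj c * cnj T + (cnj c * c) * \<tau> (star y * y)"
      by (simp add: tr yx T_def[symmetric])
    moreover have "c * T = of_real (r * (cmod T)\<^sup>2)"
      by (simp only: c_def of_real_mult complex_norm_square) (simp add: mult_ac)
    moreover have "cnj c * cnj T = of_real (r * (cmod T)\<^sup>2)"
      by (simp only: c_def of_real_mult complex_norm_square) (simp add: mult_ac)
    moreover have "cnj c * c = of_real (r\<^sup>2 * (cmod T)\<^sup>2)"
      by (simp only: c_def of_real_mult complex_norm_square) (simp add: mult_ac power2_eq_square)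
    ultimately have "Re (\<tau> (star (x - c *\<^sub>C y) * (x - c *\<^sub>C y))) =
       Re (\<tau> (star x * x)) - 2 * r * (cmod T)\<^sup>2 + r\<^sup>2 * (cmod T)\<^sup>2 * Re (\<tau> (star y * y))"
      by (simp del: of_real_mult of_real_power)
    then show ?thesis
      using tracial_state_square(1)[OF t, of "x - c *\<^sub>C y"] by (simp add: trace_norm_power2[OF t])
  qed
  then have "(cmod T)\<^sup>2 \<le> (trace_norm \<tau> x)\<^sup>2 * (trace_norm \<tau> y)\<^sup>2"
    by (intro quadratic_nonneg_imp) auto
  then show ?thesis
    unfolding T_def[symmetric] power_mult_distrib[symmetric]
    by (rule power2_le_imp_le) (simp add: t)
qed

lemma cmod_trace_mult_le:
  "\<tau> \<in> tracial_states \<Longrightarrow> cmod (\<tau> (x * y)) \<le> trace_norm \<tau> x * trace_norm \<tau> y"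
  using trace_Cauchy_Schwarz[of \<tau> "star x" y] by (simp add: star_star trace_norm_star)

lemma cmod_trace_le: "\<tau> \<in> tracial_states \<Longrightarrow> cmod (\<tau> x) \<le> trace_norm \<tau> x"
  using cmod_trace_mult_le[of \<tau> 1 x] by (simp add: trace_norm_one)

text \<open>With s a root of the squared norm of y minus \<open>star y * y\<close>, the difference
  of the two squared sides is the trace of \<open>star (s * x) * (s * x)\<close>.\<close>

lemma trace_norm_mult_left:
  assumes t: "\<tau> \<in> tracial_states"
  shows "trace_norm \<tau> (y * x) \<le> norm y * trace_norm \<tau> x"
proof (cases "y = 0")
  case False
  then obtain s where s: "star s = s" "s * s = of_real ((norm y)\<^sup>2) - star y * y"
    using positive_norm_minus[of y "(norm y)\<^sup>2"] by auto
  have "star (s * x) * (s * x) = star x * (s * s) * x" by (simp add: star_mult s(1) mult.assoc)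
  also have "\<dots> = (norm y)\<^sup>2 *\<^sub>R (star x * x) - star (y * x) * (y * x)"
    by (simp add: s(2) star_mult right_diff_distrib left_diff_distrib mult.assoc of_real_def)
  finally have "0 \<le> Re (\<tau> ((norm y)\<^sup>2 *\<^sub>R (star x * x) - star (y * x) * (y * x)))"
    using tracial_state_square(1)[OF t, of "s * x"] by simp
  then have "(trace_norm \<tau> (y * x))\<^sup>2 \<le> (norm y * trace_norm \<tau> x)\<^sup>2"
    by (simp add: tracial_state_diff[OF t] tracial_state_scaleR[OF t] trace_norm_power2[OF t]
        power_mult_distrib flip: of_real_power)
  then show ?thesis by (rule power2_le_imp_le) (simp add: t)
qed (simp add: trace_norm_def tracial_state_zero t)

text \<open>Bounding a right factor rests on the trace property, which enters through
  \<open>trace_norm_star\<close>.\<close>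

lemma trace_norm_mult_right:
  assumes t: "\<tau> \<in> tracial_states"
  shows "trace_norm \<tau> (x * y) \<le> trace_norm \<tau> x * norm y"
  using trace_norm_mult_left[OF t, of "star y" "star x"] trace_norm_star[OF t, of "x * y"]
  by (simp add: star_mult trace_norm_star[OF t] mult.commute)

lemma trace_norm_le_norm: "\<tau> \<in> tracial_states \<Longrightarrow> trace_norm \<tau> x \<le> norm x"
  using trace_norm_mult_left[of \<tau> x 1] by (simp add: trace_norm_one)

lemma cmod_trace_le_norm: "\<tau> \<in> tracial_states \<Longrightarrow> cmod (\<tau> x) \<le> norm x"
  using cmod_trace_le trace_norm_le_norm order.trans by blast

lemma trace_norm_triangle:
  assumes t: "\<tau> \<in> tracial_states"
  shows "trace_norm \<tau> (x + y) \<le> trace_norm \<tau> x + trace_norm \<tau> y"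
proof -
  have "(trace_norm \<tau> (x + y))\<^sup>2
      = (trace_norm \<tau> x)\<^sup>2 + Re (\<tau> (star x * y)) + Re (\<tau> (star y * x)) + (trace_norm \<tau> y)\<^sup>2"
    by (simp add: trace_norm_power2[OF t] star_add distrib_left distrib_right tracial_statesD(1)[OF t])
  also have "\<dots> \<le> (trace_norm \<tau> x)\<^sup>2 + trace_norm \<tau> x * trace_norm \<tau> y
      + trace_norm \<tau> y * trace_norm \<tau> x + (trace_norm \<tau> y)\<^sup>2"
    using trace_Cauchy_Schwarz[OF t, of x y] trace_Cauchy_Schwarz[OF t, of y x]
      abs_Re_le_cmod[of "\<tau> (star x * y)"] abs_Re_le_cmod[of "\<tau> (star y * x)"]
    by linarith
  also have "\<dots> = (trace_norm \<tau> x + trace_norm \<tau> y)\<^sup>2" by (simp add: power2_sum)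
  finally show ?thesis by (rule power2_le_imp_le) (simp add: t)
qed

lemma trace_projection:
  assumes "\<tau> \<in> tracial_states" "projection p"
  shows "Re (\<tau> p) = (trace_norm \<tau> p)\<^sup>2"
  using assms by (auto simp: projection_def trace_norm_power2)

lemma tracial_state_comp_star_hom:
  assumes "\<tau> \<in> tracial_states" "star_hom f"
  shows "\<tau> \<circ> f \<in> tracial_states"
proof -
  have "positive (f x)" if "positive x" for x
    using that assms(2) unfolding positive_def by (metis star_hom_simps(3,4))
  then show ?thesis
    using assms(1) unfolding tracial_states_def by (simp add: star_hom_simps[OF assms(2)])
qed

section \<open>Projections of small trace\<close>

text \<open>Neumann series: both products with it telescope.\<close>

lemma invertible_one_minus:
  fixes k :: "'a::unital_cstar_algebra"
  assumes "norm k < 1"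
  shows "invertible_elt (1 - k)"
proof -
  have "summable (\<lambda>n. norm k ^ n)" using assms by (simp add: summable_geometric)
  then have sm: "summable (\<lambda>n. k ^ n)"
    by (rule summable_comparison_test'[of _ 0]) (simp add: norm_power_ineq)
  define S where "S = (\<Sum>n. k ^ n)"
  have S: "(\<lambda>n. k ^ n) sums S" unfolding S_def using sm by (rule summable_sums)
  have tel: "(\<lambda>n. k ^ n - k ^ Suc n) sums 1"
    using telescope_sums'[OF summable_LIMSEQ_zero[OF sm]] by simp
  have "(\<lambda>n. (1 - k) * k ^ n) sums ((1 - k) * S)" using S by (rule sums_mult)
  then have "(1 - k) * S = 1" using tel sums_unique2 by (simp add: left_diff_distrib) blast
  moreover have "(\<lambda>n. k ^ n * (1 - k)) sums (S * (1 - k))" using S by (rule sums_mult2)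
  then have "S * (1 - k) = 1"
    using tel sums_unique2 by (simp add: right_diff_distrib power_commutes) blast
  ultimately show ?thesis unfolding invertible_elt_def by blast
qed

text \<open>Once \<open>x * a * x\<close> is within 1 of the unit it is invertible, which hands x an
  inverse on each side. Together with finiteness this excludes the zero tower below a noninvertible
  x.\<close>

lemma one_in_hereditary_subalgebra:
  fixes x :: "'a::unital_cstar_algebra"
  assumes "1 \<in> hereditary_subalgebra x"
  shows "invertible_elt x"
proof -
  obtain a where "norm (x * a * x - 1) < 1"
    using assms unfolding hereditary_subalgebra_def closure_approachable
    by (auto simp: dist_norm dest: spec[of _ 1])
  then have "norm (1 - x * a * x) < 1" by (simp add: norm_minus_commute)
  then have "invertible_elt (x * a * x)" using invertible_one_minus by fastforce
  then obtain g where "x * (a * x * g) = 1" "(g * x * a) * x = 1"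
    unfolding invertible_elt_def by (auto simp: mult.assoc)
  then show ?thesis by (rule invertible_elt_if_left_right)
qed

text \<open>This is the case n = 1: \<open>E\<close> identifies the algebra with the corner at (0,
  0), compatibly with product, adjoint and unit.\<close>

lemma stably_finite_imp_finite:
  fixes q :: "'a::unital_cstar_algebra"
  assumes "stably_finite TYPE('a)" "projection q" "mvn_equiv 1 q"
  shows "q = 1"
proof -
  define E where "E a = (\<lambda>i j. if i = (0::nat) \<and> j = (0::nat) then a else 0 :: 'a)" for a
  have mult: "mat_mult (E a) (E b) = E (a * b)" for a b
  proof (intro ext)
    fix i k :: nat
    \<comment> \<open>\<open>mat_mult\<close> sums over the nonzero entries of a row, so the index
      set is empty when \<open>a\<close> = 0.\<close>
    have "{j. E a i j \<noteq> 0} = (if i = 0 \<and> a \<noteq> 0 then {0} else {})" by (auto simp: E_def)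
    then show "mat_mult (E a) (E b) i k = E (a * b) i k"
      by (auto simp: mat_mult_def) (auto simp: E_def)
  qed
  have star: "mat_star (E a) = E (star a)" for a
    by (auto simp: mat_star_def E_def fun_eq_iff)
  have inf: "E a \<in> mat_inf" for a
    unfolding mat_inf_def mat_n_def E_def by (auto intro!: bexI[of _ 1])
  have one: "mat_one 1 = E 1" by (auto simp: mat_one_def E_def fun_eq_iff)
  obtain v where "star v * v = 1" "v * star v = q" using assms(3) unfolding mvn_equiv_def by blast
  then have "mat_mvn_equiv (mat_one 1) (E q)"
    unfolding mat_mvn_equiv_def using inf by (metis mult one star)
  moreover have "mat_subprojection (E q) (mat_one 1)"
    using assms(2) inf unfolding mat_subprojection_def mat_projection_def one mult star projection_def by simp
  ultimately have "E q = mat_one 1" using assms(1) unfolding stably_finite_def by blast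
  then have "E q = E 1" by (simp only: one)
  then have "E q 0 0 = E 1 0 0" by simp
  then show ?thesis by (simp add: E_def)
qed

text \<open>By the C*-identity the norm of p equals its square. The consequence used below is that a
  projection of norm less than 1 is zero.\<close>

lemma norm_projection:
  fixes p :: "'a::unital_cstar_algebra"
  assumes "projection p"
  shows "p = 0 \<or> norm p = 1"
  using cstar_identity[of p] assms by (auto simp: projection_def power2_eq_square)

lemma sum_trace_projections_le_1:
  assumes t: "\<tau> \<in> tracial_states" and I: "finite I"
    and p: "\<And>i. i \<in> I \<Longrightarrow> projection (e i)"
    and orth: "\<And>i j. i \<in> I \<Longrightarrow> j \<in> I \<Longrightarrow> i \<noteq> j \<Longrightarrow> e i * e j = 0"
  shows "projection (1 - (\<Sum>i\<in>I. e i))" "(\<Sum>i\<in>I. Re (\<tau> (e i))) \<le> 1"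
proof -
  let ?s = "\<Sum>i\<in>I. e i"
  have "star ?s = ?s" using p by (simp add: star_sum projection_def)
  moreover have "?s * ?s = ?s"
  proof -
    have "?s * ?s = (\<Sum>i\<in>I. \<Sum>j\<in>I. e i * e j)" by (simp add: sum_product)
    also have "\<dots> = (\<Sum>i\<in>I. \<Sum>j\<in>I. if i = j then e i else 0)"
      using p orth by (intro sum.cong) (auto simp: projection_def)
    finally show ?thesis using I by simp
  qed
  ultimately show pr: "projection (1 - ?s)"
    unfolding projection_def by (simp add: star_diff algebra_simps)
  have "0 \<le> Re (\<tau> (1 - ?s))" using trace_projection[OF t pr] by simp
  then show "(\<Sum>i\<in>I. Re (\<tau> (e i))) \<le> 1"
    by (simp add: tracial_state_diff[OF t] tracial_state_sum[OF t] tracial_statesD[OF t])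
qed

text \<open>Pigeonhole: n + 1 orthogonal projections have total trace at most 1, so one of them has
  trace below \<delta> once n \<delta> > 1. The rest of the proof shows that no level is
  zero.\<close>

lemma exists_small_projection:
  fixes \<alpha> :: "'a::unital_cstar_algebra \<Rightarrow> 'a" and \<tau> :: "'a \<Rightarrow> complex"
  assumes sf: "stably_finite TYPE('a)" and nd: "\<not> one_dimensional TYPE('a)"
    and \<alpha>: "star_automorphism \<alpha>" and R: "tracial_rokhlin_property \<alpha>"
    and t: "\<tau> \<in> tracial_states" and \<delta>: "\<delta> > 0"
  shows "\<exists>p. projection p \<and> p \<noteq> 0 \<and> Re (\<tau> p) < \<delta>"
proof -
  obtain x :: 'a where x: "positive x" "x \<noteq> 0" "\<not> invertible_elt x"
    using exists_noninvertible_positive[OF nd] by blast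
  obtain n :: nat where n: "1 / \<delta> < real n" using reals_Archimedean2 by blast
  \<comment> \<open>Tolerance 1 and an empty finite set suffice: it only matters that neighbouring
    levels vanish together.\<close>
  have "\<exists>e. (\<forall>j\<le>n. projection (e j)) \<and>
          (\<forall>i\<le>n. \<forall>j\<le>n. i \<noteq> j \<longrightarrow> e i * e j = 0) \<and>
          (\<forall>j<n. norm (\<alpha> (e j) - e (j + 1)) < 1) \<and>
          (\<exists>q\<in>hereditary_subalgebra x. projection q \<and> mvn_equiv (1 - (\<Sum>j\<le>n. e j)) q)"
    using R[unfolded tracial_rokhlin_property_def, rule_format, of "{}" 1 x n] x(1,2) by simp
  then obtain e :: "nat \<Rightarrow> 'a" and q where e: "\<And>j. j \<le> n \<Longrightarrow> projection (e j)"
      "\<And>i j. i \<le> n \<Longrightarrow> j \<le> n \<Longrightarrow> i \<noteq> j \<Longrightarrow> e i * e j = 0"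
      "\<And>j. j < n \<Longrightarrow> norm (\<alpha> (e j) - e (j + 1)) < 1"
    and q: "q \<in> hereditary_subalgebra x" "projection q" "mvn_equiv (1 - (\<Sum>j\<le>n. e j)) q"
    by blast
  have hom: "star_hom \<alpha>" and inj: "inj \<alpha>" using \<alpha> by (auto simp: star_automorphism_def bij_def)
  have \<alpha>0: "\<alpha> a = 0 \<longleftrightarrow> a = 0" for a
    using inj star_hom_zero[OF hom] by (metis injD)
  have pr: "projection (\<alpha> p)" if "projection p" for p
    using that star_hom_simps(3,4)[OF hom] unfolding projection_def by metis
  \<comment> \<open>\<open>\<alpha> (e j)\<close> is a projection as well, and of two projections at
    distance below 1 neither can vanish alone.\<close>
  have step: "e (Suc j) = 0 \<longleftrightarrow> e j = 0" if "j < n" for j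
  proof
    assume "e (Suc j) = 0"
    then have "norm (\<alpha> (e j)) < 1" using e(3)[OF that] by simp
    then show "e j = 0" using norm_projection[OF pr[OF e(1)[of j]]] that \<alpha>0 by auto
  next
    assume "e j = 0"
    then have "norm (e (Suc j)) < 1" using e(3)[OF that] by (simp add: star_hom_zero[OF hom])
    then show "e (Suc j) = 0" using norm_projection[OF e(1)[of "Suc j"]] that by auto
  qed
  have all: "e j = 0 \<longleftrightarrow> e 0 = 0" if "j \<le> n" for j
    using that by (induction j) (auto simp: step)
  have nz: "e j \<noteq> 0" if "j \<le> n" for j
  proof
    assume "e j = 0"
    then have "e 0 = 0" using all[OF that] by blast
    then have "e i = 0" if "i \<le> n" for i using all[OF that] by blast
    then have "(\<Sum>j\<le>n. e j) = 0" by simp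
    then have "q = 1" using stably_finite_imp_finite[OF sf q(2)] q(3) by simp
    then show False using q(1) one_in_hereditary_subalgebra x(3) by blast
  qed
  have "\<exists>j\<le>n. Re (\<tau> (e j)) < \<delta>"
  proof (rule ccontr)
    assume "\<not> ?thesis"
    then have "(\<Sum>j\<le>n. Re (\<tau> (e j))) \<ge> (\<Sum>j\<le>n. \<delta>)" by (intro sum_mono) (auto simp: not_less)
    moreover have "(\<Sum>j\<le>n. Re (\<tau> (e j))) \<le> 1"
      by (rule sum_trace_projections_le_1(2)[OF t]) (use e in auto)
    moreover have "1 < real n * \<delta>" using n \<delta> by (simp add: field_simps)
    ultimately show False using \<delta> by (simp add: distrib_right)
  qed
  then show ?thesis using e(1) nz by blast
qed

text \<open>p acts as a unit on both sides of its closed corner, so q is a subprojection of p and p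
  - q is a projection.\<close>

lemma trace_le_of_hereditary:
  assumes t: "\<tau> \<in> tracial_states" and p: "projection p" and q: "projection q"
    and qp: "q \<in> hereditary_subalgebra p"
  shows "Re (\<tau> q) \<le> Re (\<tau> p)"
proof -
  have "hereditary_subalgebra p \<subseteq> {y. p * y = y} \<inter> {y. y * p = y}"
    unfolding hereditary_subalgebra_def
  proof (rule closure_minimal)
    show "{p * a * p |a. True} \<subseteq> {y. p * y = y} \<inter> {y. y * p = y}"
    proof safe
      fix a
      have pp: "p * p = p" using p by (simp add: projection_def)
      show "p * (p * a * p) = p * a * p" by (simp add: pp flip: mult.assoc)
      show "p * a * p * p = p * a * p" by (simp add: pp mult.assoc)
    qed
    show "closed ({y. p * y = y} \<inter> {y. y * p = y})"
      by (intro closed_Int closed_Collect_eq continuous_intros)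
  qed
  then have "p * q = q" "q * p = q" using qp by auto
  then have "projection (p - q)"
    using p q unfolding projection_def by (simp add: star_diff left_diff_distrib right_diff_distrib)
  then have "0 \<le> Re (\<tau> (p - q))" using trace_projection[OF t] by simp
  then show ?thesis by (simp add: tracial_state_diff[OF t])
qed

section \<open>Powers of the automorphism and of the unitary\<close>

text \<open>Passing from k to k + 1 applies \<alpha> or left multiplication by u, both reversible,
  so the step is available as an equivalence; it serves both directions and spares negative powers
  an argument of their own.\<close>

lemma int_shift_induct:
  fixes P :: "int \<Rightarrow> bool"
  assumes "P 0" "\<And>k. P (k + 1) \<longleftrightarrow> P k"
  shows "P k"
proof (induction k rule: int_induct[where k = 0])
  case (step2 i)
  then show ?case using assms(2)[of "i - 1"] by simp
qed (use assms in auto)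

lemma aut_pow_0 [simp]: "aut_pow \<alpha> 0 a = a"
  by (simp add: aut_pow_def)

lemma aut_pow_Suc:
  assumes "bij \<alpha>"
  shows "aut_pow \<alpha> (k + 1) a = \<alpha> (aut_pow \<alpha> k a)"
proof (cases "0 \<le> k")
  case True
  then have "nat (k + 1) = Suc (nat k)" by simp
  then show ?thesis using True by (simp add: aut_pow_def)
next
  case False
  then have "nat (- k) = Suc (nat (- (k + 1)))" by simp
  then have "\<alpha> (aut_pow \<alpha> k a) = \<alpha> (inv \<alpha> ((inv \<alpha> ^^ nat (- (k + 1))) a))"
    using False by (simp add: aut_pow_def)
  also have "\<dots> = (inv \<alpha> ^^ nat (- (k + 1))) a"
    using assms by (simp add: bij_is_surj surj_f_inv_f)
  \<comment> \<open>At k = -1 the successor 0 falls under the other branch of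
    \<open>aut_pow_def\<close>.\<close>
  also have "\<dots> = aut_pow \<alpha> (k + 1) a" using False by (cases "k = -1") (auto simp: aut_pow_def)
  finally show ?thesis by simp
qed

lemma aut_pow_add:
  assumes "bij \<alpha>"
  shows "aut_pow \<alpha> (k + l) a = aut_pow \<alpha> k (aut_pow \<alpha> l a)"
proof (induction k rule: int_shift_induct)
  case (2 k)
  have "k + 1 + l = (k + l) + 1" by simp
  then show ?case using assms by (simp only: aut_pow_Suc[OF assms] inj_eq[OF bij_is_inj[OF assms]])
qed simp

lemma star_hom_aut_pow:
  assumes "star_automorphism \<alpha>"
  shows "star_hom (aut_pow \<alpha> k)"
proof (induction k rule: int_shift_induct)
  case (2 k)
  have hom: "star_hom \<alpha>" and b: "bij \<alpha>" using assms by (auto simp: star_automorphism_def)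
  have inj: "\<alpha> x = \<alpha> y \<longleftrightarrow> x = y" for x y using b by (simp add: bij_is_inj inj_eq)
  \<comment> \<open>The unit clause is not of the form \<alpha> x = \<alpha> y until 1 is written as
    \<open>\<alpha> 1\<close>.\<close>
  have "\<alpha> x = 1 \<longleftrightarrow> x = 1" for x using inj star_hom_simps(5)[OF hom] by metis
  then show ?case
    unfolding star_hom_def
    by (simp add: aut_pow_Suc[OF b] star_hom_simps(1-4)[OF hom, symmetric] inj)
qed (simp add: star_hom_def)

lemma aut_pow_invariant:
  assumes "bij \<alpha>" "\<And>a. \<tau> (\<alpha> a) = \<tau> a"
  shows "\<tau> (aut_pow \<alpha> k a) = \<tau> a"
  by (induction k rule: int_shift_induct) (simp_all add: aut_pow_Suc assms)

lemma unitary_pow_0 [simp]: "unitary_pow u 0 = 1"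
  by (simp add: unitary_pow_def)

lemma unitary_pow_Suc:
  assumes "unitary u"
  shows "unitary_pow u (k + 1) = u * unitary_pow u k"
proof (cases "0 \<le> k")
  case True
  then have "nat (k + 1) = Suc (nat k)" by simp
  then show ?thesis using True by (simp add: unitary_pow_def)
next
  case False
  then have "nat (- k) = Suc (nat (- (k + 1)))" by simp
  then have "u * unitary_pow u k = u * star u * star u ^ nat (- (k + 1))"
    using False by (simp add: unitary_pow_def mult.assoc)
  also have "\<dots> = star u ^ nat (- (k + 1))" using assms by (simp add: unitary_def)
  also have "\<dots> = unitary_pow u (k + 1)" using False by (cases "k = -1") (auto simp: unitary_pow_def)
  finally show ?thesis by simp
qed

lemma unitary_cancel_left:
  assumes "unitary u"
  shows "u * x = u * y \<longleftrightarrow> x = y"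
proof
  assume "u * x = u * y"
  then have "star u * u * x = star u * u * y" by (simp add: mult.assoc)
  then show "x = y" using assms by (simp add: unitary_def)
qed simp

lemma unitary_pow_add:
  assumes "unitary u"
  shows "unitary_pow u (k + l) = unitary_pow u k * unitary_pow u l"
proof (induction k rule: int_shift_induct)
  case (2 k)
  have "k + 1 + l = (k + l) + 1" by simp
  then show ?case
    by (simp only: unitary_pow_Suc[OF assms] mult.assoc unitary_cancel_left[OF assms])
qed simp

lemma star_unitary_pow: "star (unitary_pow u k) = unitary_pow u (- k)"
  by (auto simp: unitary_pow_def star_power star_star)

lemma norm_unitary_pow:
  assumes "unitary u"
  shows "norm (unitary_pow u k) = 1"
proof -
  have "star (unitary_pow u k) * unitary_pow u k = 1"
    using unitary_pow_add[OF assms, of "- k" k] by (simp add: star_unitary_pow)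
  then have "(norm (unitary_pow u k))\<^sup>2 = 1" by (simp flip: cstar_identity)
  then show ?thesis using norm_ge_zero[of "unitary_pow u k"] by (simp add: power2_eq_1_iff)
qed

lemma unitary_pow_covariant:
  assumes u: "unitary u" and b: "bij \<alpha>" and cov: "\<And>a. u * \<iota> a * star u = \<iota> (\<alpha> a)"
  shows "unitary_pow u k * \<iota> a = \<iota> (aut_pow \<alpha> k a) * unitary_pow u k"
proof (induction k rule: int_shift_induct)
  case (2 k)
  have "\<iota> (\<alpha> a) * u = u * \<iota> a" for a
    unfolding cov[symmetric] using u by (simp add: unitary_def mult.assoc)
  then have "\<iota> (\<alpha> x) * (u * y) = u * (\<iota> x * y)" for x y by (metis mult.assoc)
  then show ?case
    by (simp only: aut_pow_Suc[OF b] unitary_pow_Suc[OF u] mult.assoc unitary_cancel_left[OF u])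
qed simp

section \<open>Tracial states on the crossed product vanish off the diagonal\<close>

text \<open>Conjugation by u implements \<alpha>, and a trace does not see conjugation; hence
  restrictions of traces are invariant.\<close>

lemma trace_unitary_invariant:
  assumes "\<sigma> \<in> tracial_states" "unitary u" "\<And>a. u * \<iota> a * star u = \<iota> (\<alpha> a)"
  shows "\<sigma> (\<iota> (\<alpha> a)) = \<sigma> (\<iota> a)"
  unfolding assms(3)[symmetric] using assms(2)
  by (subst tracial_statesD(5)[OF assms(1)]) (simp add: unitary_def flip: mult.assoc)

lemma trace_norm_invariant:
  assumes "star_hom \<alpha>" "\<And>a. \<tau> (\<alpha> a) = \<tau> a"
  shows "trace_norm \<tau> (\<alpha> a) = trace_norm \<tau> a"
  by (simp add: trace_norm_def assms(2) flip: star_hom_simps[OF assms(1)])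

text \<open>Neighbouring levels have traces at most \<eta> apart, so each exceeds any other by at
  most N \<eta>. Averaging over N + 1 levels of total trace at most 1 bounds each by 1 / (N + 1) + N
  \<eta>, and the assumed bound on \<eta> makes the second summand at most 1 / (N + 1).\<close>

lemma Rokhlin_tower_trace_le:
  assumes t: "\<tau> \<in> tracial_states" and inv: "\<And>a. \<tau> (\<alpha> a) = \<tau> a"
    and e: "\<And>j. j \<le> N \<Longrightarrow> projection (e j)"
      "\<And>i j. i \<le> N \<Longrightarrow> j \<le> N \<Longrightarrow> i \<noteq> j \<Longrightarrow> e i * e j = 0"
      "\<And>j. j < N \<Longrightarrow> norm (\<alpha> (e j) - e (j + 1)) < \<eta>"
    and \<eta>: "0 < \<eta>" "\<eta> \<le> 1 / (real N + 1)\<^sup>2" and j: "j \<le> N"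
  shows "Re (\<tau> (e j)) \<le> 2 / (real N + 1)"
proof -
  have step: "\<bar>Re (\<tau> (e (Suc i))) - Re (\<tau> (e i))\<bar> \<le> \<eta>" if "i < N" for i
  proof -
    have "\<bar>Re (\<tau> (\<alpha> (e i) - e (i + 1)))\<bar> \<le> norm (\<alpha> (e i) - e (i + 1))"
      using abs_Re_le_cmod cmod_trace_le_norm[OF t] order.trans by blast
    then show ?thesis using e(3)[OF that] by (simp add: tracial_state_diff[OF t] inv)
  qed
  have dist: "\<bar>Re (\<tau> (e (i + k))) - Re (\<tau> (e i))\<bar> \<le> real k * \<eta>" if "i + k \<le> N" for i k
    using that
  proof (induction k)
    case (Suc k)
    then show ?case using step[of "i + k"] by (simp add: algebra_simps)
  qed simp
  have "Re (\<tau> (e j)) \<le> Re (\<tau> (e i)) + real N * \<eta>" if "i \<le> N" for i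
  proof -
    have "\<exists>k\<le>N. \<bar>Re (\<tau> (e j)) - Re (\<tau> (e i))\<bar> \<le> real k * \<eta>"
    proof (cases "i \<le> j")
      case True
      then show ?thesis using dist[of i "j - i"] j by (intro exI[of _ "j - i"]) auto
    next
      case False
      then show ?thesis using dist[of j "i - j"] that
        by (intro exI[of _ "i - j"]) (auto simp: abs_minus_commute)
    qed
    then obtain k where k: "k \<le> N" "\<bar>Re (\<tau> (e j)) - Re (\<tau> (e i))\<bar> \<le> real k * \<eta>" by blast
    moreover have "real k * \<eta> \<le> real N * \<eta>" using k(1) \<eta>(1) by simp
    ultimately show ?thesis by linarith
  qed
  then have "(\<Sum>i\<le>N. Re (\<tau> (e j))) \<le> (\<Sum>i\<le>N. Re (\<tau> (e i)) + real N * \<eta>)"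
    by (intro sum_mono) auto
  also have "\<dots> \<le> 1 + (real N + 1) * (real N * \<eta>)"
  proof -
    have "(\<Sum>i\<le>N. Re (\<tau> (e i))) \<le> 1"
      by (rule sum_trace_projections_le_1(2)[OF t]) (use e in auto)
    then show ?thesis by (simp add: sum.distrib add.commute)
  qed
  also have "\<dots> \<le> 2"
  proof -
    have "(real N + 1) * (real N * \<eta>) \<le> (real N + 1)\<^sup>2 * \<eta>"
      using \<eta>(1) by (simp add: power2_eq_square algebra_simps)
    also have "\<dots> \<le> 1" using \<eta>(2) by (simp add: field_simps)
    finally show ?thesis by simp
  qed
  finally show ?thesis by (simp add: field_simps)
qed

text \<open>Cut \<open>a\<close> along the tower into the pieces \<open>e j * a\<close> and
  \<open>r * a\<close>. The three terms of the bound belong, in turn, to the levels with j + n \<le>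
  N, to the n topmost levels, and to the remainder r.\<close>

lemma trace_unitary_pow_estimate:
  fixes \<alpha> :: "'a::unital_cstar_algebra \<Rightarrow> 'a" and \<sigma> :: "'b::unital_cstar_algebra \<Rightarrow> complex"
  assumes s: "\<sigma> \<in> tracial_states" and hom: "star_hom \<iota>" and \<alpha>: "star_automorphism \<alpha>"
    and u: "unitary u" and cov: "\<And>a. u * \<iota> a * star u = \<iota> (\<alpha> a)"
    and R: "tracial_rokhlin_property \<alpha>"
    and \<eta>: "0 < \<eta>" "\<eta> \<le> 1 / (real N + 1)\<^sup>2" and nN: "1 \<le> n" "n \<le> N"
    and p: "projection p" "p \<noteq> 0"
  shows "cmod (\<sigma> (\<iota> a * unitary_pow u (int n))) \<le>
    (real N + 1) * ((norm a * real n + 1) * \<eta>) + real n * (norm a * sqrt (2 / (real N + 1)))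
     + norm a * sqrt (Re (\<sigma> (\<iota> p)))"
proof -
  define \<tau> where "\<tau> = \<sigma> \<circ> \<iota>"
  have t: "\<tau> \<in> tracial_states" unfolding \<tau>_def by (rule tracial_state_comp_star_hom[OF s hom])
  have inv: "\<tau> (\<alpha> x) = \<tau> x" for x
    unfolding \<tau>_def using trace_unitary_invariant[of \<sigma> u \<iota> \<alpha>, OF s u cov] by simp
  have b: "bij \<alpha>" and \<alpha>h: "star_hom \<alpha>" using \<alpha> by (auto simp: star_automorphism_def)
  define U where "U = unitary_pow u (int n)"
  define \<beta> where "\<beta> k = aut_pow \<alpha> (int k)" for k
  have U: "norm U = 1" unfolding U_def by (rule norm_unitary_pow[OF u])
  \<comment> \<open>Brings the estimates back to the trace seminorm on the coefficient algebra,
    since \<open>U\<close> has norm 1.\<close>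
  have est: "cmod (\<sigma> (\<iota> z * U)) \<le> trace_norm \<tau> z" for z
  proof -
    have "cmod (\<sigma> (\<iota> z * U)) \<le> trace_norm \<sigma> (\<iota> z) * trace_norm \<sigma> U" by (rule cmod_trace_mult_le[OF s])
    also have "\<dots> \<le> trace_norm \<sigma> (\<iota> z) * 1"
      using trace_norm_le_norm[OF s, of U] U by (intro mult_left_mono) (auto simp: s)
    also have "trace_norm \<sigma> (\<iota> z) = trace_norm \<tau> z"
      by (simp add: trace_norm_def \<tau>_def flip: star_hom_simps[OF hom])
    finally show ?thesis by simp
  qed
  have pp: "p = star p * p" using p(1) by (simp add: projection_def)
  then have "positive p" unfolding positive_def by blast
  then have "\<exists>e. (\<forall>j\<le>N. projection (e j)) \<and>
          (\<forall>i\<le>N. \<forall>j\<le>N. i \<noteq> j \<longrightarrow> e i * e j = 0) \<and>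
          (\<forall>j<N. norm (\<alpha> (e j) - e (j + 1)) < \<eta>) \<and>
          (\<forall>j\<le>N. norm (e j * a - a * e j) < \<eta>) \<and>
          (\<exists>q\<in>hereditary_subalgebra p. projection q \<and> mvn_equiv (1 - (\<Sum>j\<le>N. e j)) q)"
    using R[unfolded tracial_rokhlin_property_def, rule_format, of "{a}" \<eta> p N] \<eta>(1) p(2) by simp
  then obtain e where E: "(\<forall>j\<le>N. projection (e j)) \<and>
          (\<forall>i\<le>N. \<forall>j\<le>N. i \<noteq> j \<longrightarrow> e i * e j = 0) \<and>
          (\<forall>j<N. norm (\<alpha> (e j) - e (j + 1)) < \<eta>) \<and>
          (\<forall>j\<le>N. norm (e j * a - a * e j) < \<eta>) \<and>
          (\<exists>q\<in>hereditary_subalgebra p. projection q \<and> mvn_equiv (1 - (\<Sum>j\<le>N. e j)) q)"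
    by (rule exE)
  note e = E[THEN conjunct1, rule_format] E[THEN conjunct2, THEN conjunct1, rule_format]
    E[THEN conjunct2, THEN conjunct2, THEN conjunct1, rule_format]
    E[THEN conjunct2, THEN conjunct2, THEN conjunct2, THEN conjunct1, rule_format]
  obtain q where q: "q \<in> hereditary_subalgebra p" "projection q" "mvn_equiv (1 - (\<Sum>j\<le>N. e j)) q"
    using E[THEN conjunct2, THEN conjunct2, THEN conjunct2, THEN conjunct2] by (elim bexE conjE)
  have ne: "norm (e j) \<le> 1" if "j \<le> N" for j using norm_projection[OF e(1)[OF that]] by auto
  define r where "r = 1 - (\<Sum>j\<le>N. e j)"
  have r: "projection r" unfolding r_def by (rule sum_trace_projections_le_1(1)[OF t]) (use e in auto)
  \<comment> \<open>The remainder is equivalent to a subprojection of \<open>p\<close>, so its trace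
    is at most that of \<open>p\<close>; the square root comes from passing to the 2-norm.\<close>
  have rest: "cmod (\<sigma> (\<iota> (r * a) * U)) \<le> norm a * sqrt (Re (\<sigma> (\<iota> p)))"
  proof -
    obtain v where "star v * v = r" "v * star v = q" using q(3) unfolding mvn_equiv_def r_def by blast
    then have "\<tau> r = \<tau> q" using tracial_statesD(5)[OF t] by metis
    then have "Re (\<tau> r) \<le> Re (\<tau> p)" using trace_le_of_hereditary[OF t p(1) q(2,1)] by simp
    then have "trace_norm \<tau> r \<le> sqrt (Re (\<tau> p))"
      using trace_projection[OF t r] by (simp add: real_le_rsqrt)
    then have "trace_norm \<tau> (r * a) \<le> sqrt (Re (\<tau> p)) * norm a"
      using trace_norm_mult_right[OF t, of r a] by (meson mult_right_mono norm_ge_zero order.trans)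
    then show ?thesis using est[of "r * a"] by (simp add: \<tau>_def mult.commute)
  qed
  have high: "cmod (\<sigma> (\<iota> (e j * a) * U)) \<le> norm a * sqrt (2 / (real N + 1))" if j: "j \<le> N" for j
  proof -
    have "Re (\<tau> (e j)) \<le> 2 / (real N + 1)"
      by (rule Rokhlin_tower_trace_le[OF t, of \<alpha> N e \<eta>]) (use e \<eta> inv j in auto)
    then have "trace_norm \<tau> (e j) \<le> sqrt (2 / (real N + 1))"
      using trace_projection[OF t e(1)[OF j]] by (simp add: real_le_rsqrt)
    then have "trace_norm \<tau> (e j * a) \<le> sqrt (2 / (real N + 1)) * norm a"
      using trace_norm_mult_right[OF t, of "e j" a] by (meson mult_right_mono norm_ge_zero order.trans)
    then show ?thesis using est[of "e j * a"] by (simp add: mult.commute)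
  qed
  \<comment> \<open>Each of the k shifts costs \<eta>: \<alpha> preserves the seminorm of the
    invariant \<tau>, so earlier errors are carried along unchanged.\<close>
  have tower: "trace_norm \<tau> (\<beta> k (e j) - e (j + k)) \<le> real k * \<eta>" if "j + k \<le> N" for j k
    using that
  proof (induction k)
    case 0
    then show ?case by (simp add: \<beta>_def trace_norm_def tracial_state_zero[OF t])
  next
    case (Suc k)
    have "\<beta> (Suc k) (e j) = \<alpha> (\<beta> k (e j))"
      using aut_pow_Suc[OF b, of "int k"] by (simp add: \<beta>_def add.commute)
    then have "\<beta> (Suc k) (e j) - e (j + Suc k)
        = \<alpha> (\<beta> k (e j) - e (j + k)) + (\<alpha> (e (j + k)) - e (j + k + 1))"
      by (simp add: star_hom_diff[OF \<alpha>h])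
    then have "trace_norm \<tau> (\<beta> (Suc k) (e j) - e (j + Suc k))
        \<le> trace_norm \<tau> (\<beta> k (e j) - e (j + k)) + trace_norm \<tau> (\<alpha> (e (j + k)) - e (j + k + 1))"
      using trace_norm_triangle[OF t] trace_norm_invariant[of \<alpha> \<tau>, OF \<alpha>h inv] by metis
    also have "\<dots> \<le> real k * \<eta> + \<eta>"
      using Suc trace_norm_le_norm[OF t, of "\<alpha> (e (j + k)) - e (j + k + 1)"] e(3)[of "j + k"]
      by simp
    finally show ?case by (simp add: algebra_simps)
  qed
  have low: "cmod (\<sigma> (\<iota> (e j * a) * U)) \<le> (norm a * real n + 1) * \<eta>" if j: "j + n \<le> N" for j
  proof -
    have idem: "e j * e j = e j" using e(1)[of j] j by (simp add: projection_def)
    have orth: "e j * e (j + n) = 0" by (rule e(2)) (use j nN in auto)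
    \<comment> \<open>One copy of the idempotent \<open>e j\<close> is moved around cyclically and
      pulled through \<open>U\<close> by covariance, becoming
      \<open>\<beta> n (e j)\<close>.\<close>
    have "\<sigma> (\<iota> (e j * a) * U) = \<sigma> (\<iota> (e j) * (\<iota> (e j * a) * U))"
      by (simp add: idem flip: mult.assoc star_hom_simps(3)[OF hom])
    also have "\<dots> = \<sigma> (\<iota> (e j * a) * (U * \<iota> (e j)))"
      using tracial_statesD(5)[OF s] by (metis mult.assoc)
    also have "\<dots> = \<sigma> (\<iota> (e j * a * \<beta> n (e j)) * U)"
      unfolding U_def \<beta>_def unitary_pow_covariant[of u \<alpha> \<iota>, OF u b cov]
      by (simp add: star_hom_simps(3)[OF hom] mult.assoc)
    finally have 1: "cmod (\<sigma> (\<iota> (e j * a) * U)) \<le> trace_norm \<tau> (e j * a * \<beta> n (e j))"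
      using est by simp
    \<comment> \<open>\<open>e j * a * e (j + n)\<close> equals the commutator times
      \<open>e (j + n)\<close>, as the two levels are orthogonal.\<close>
    have "e j * a * \<beta> n (e j) = e j * a * (\<beta> n (e j) - e (j + n)) + (e j * a - a * e j) * e (j + n)"
      by (simp add: algebra_simps orth)
    then have "trace_norm \<tau> (e j * a * \<beta> n (e j)) \<le>
       trace_norm \<tau> (e j * a * (\<beta> n (e j) - e (j + n))) + trace_norm \<tau> ((e j * a - a * e j) * e (j + n))"
      using trace_norm_triangle[OF t] by metis
    also have "\<dots> \<le> norm (e j * a) * trace_norm \<tau> (\<beta> n (e j) - e (j + n))
        + norm ((e j * a - a * e j) * e (j + n))"
      using trace_norm_mult_left[OF t] trace_norm_le_norm[OF t] by (intro add_mono) auto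
    also have "\<dots> \<le> norm a * (real n * \<eta>) + \<eta> * 1"
    proof (intro add_mono)
      have "norm (e j * a) \<le> 1 * norm a"
        using norm_mult_ineq[of "e j" a] ne[of j] j by (meson mult_right_mono norm_ge_zero order.trans add_leD1)
      then show "norm (e j * a) * trace_norm \<tau> (\<beta> n (e j) - e (j + n)) \<le> norm a * (real n * \<eta>)"
        using tower[OF j] by (intro mult_mono) (auto simp: t)
      show "norm ((e j * a - a * e j) * e (j + n)) \<le> \<eta> * 1"
        using e(4)[of j] j ne[of "j + n"] \<eta>(1)
        by (intro order.trans[OF norm_mult_ineq] mult_mono) auto
    qed
    finally show ?thesis using 1 by (simp add: algebra_simps)
  qed
  have "a = (\<Sum>j\<le>N. e j * a) + r * a"
    by (simp add: r_def left_diff_distrib flip: sum_distrib_right)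
  then have "\<sigma> (\<iota> a * U) = \<sigma> (\<iota> ((\<Sum>j\<le>N. e j * a) + r * a) * U)" by simp
  also have "\<dots> = (\<Sum>j\<le>N. \<sigma> (\<iota> (e j * a) * U)) + \<sigma> (\<iota> (r * a) * U)"
    by (simp add: star_hom_simps(1)[OF hom] star_hom_sum[OF hom] distrib_right sum_distrib_right
        tracial_statesD(1)[OF s] tracial_state_sum[OF s])
  finally have "cmod (\<sigma> (\<iota> a * U)) \<le> (\<Sum>j\<le>N. cmod (\<sigma> (\<iota> (e j * a) * U))) + cmod (\<sigma> (\<iota> (r * a) * U))"
    by (simp only:) (intro order.trans[OF norm_triangle_ineq] add_right_mono norm_sum)
  moreover have "(\<Sum>j\<le>N. cmod (\<sigma> (\<iota> (e j * a) * U)))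
    = (\<Sum>j\<le>N - n. cmod (\<sigma> (\<iota> (e j * a) * U))) + (\<Sum>j\<in>{N - n<..N}. cmod (\<sigma> (\<iota> (e j * a) * U)))"
    by (subst sum.union_disjoint[symmetric]) (auto intro!: sum.cong)
  moreover have "(\<Sum>j\<le>N - n. cmod (\<sigma> (\<iota> (e j * a) * U))) \<le> (\<Sum>j\<le>N - n. (norm a * real n + 1) * \<eta>)"
    using nN by (intro sum_mono low) auto
  moreover have "\<dots> \<le> (real N + 1) * ((norm a * real n + 1) * \<eta>)"
    using \<eta>(1) by (simp add: mult_right_mono)
  moreover have "(\<Sum>j\<in>{N - n<..N}. cmod (\<sigma> (\<iota> (e j * a) * U)))
      \<le> (\<Sum>j\<in>{N - n<..N}. norm a * sqrt (2 / (real N + 1)))"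
    by (intro sum_mono high) auto
  moreover have "\<dots> = real n * (norm a * sqrt (2 / (real N + 1)))" using nN by simp
  ultimately show ?thesis using rest unfolding U_def by linarith
qed

text \<open>For fixed N the choice of \<eta> and of p makes the first and third terms of the
  estimate at most \<epsilon> / 2 each; the middle term, free of \<epsilon>, tends to 0 as N
  grows.\<close>

lemma trace_unitary_pow_eq_0:
  fixes \<alpha> :: "'a::unital_cstar_algebra \<Rightarrow> 'a" and \<sigma> :: "'b::unital_cstar_algebra \<Rightarrow> complex"
  assumes sf: "stably_finite TYPE('a)" and nd: "\<not> one_dimensional TYPE('a)"
    and s: "\<sigma> \<in> tracial_states" and hom: "star_hom \<iota>" and \<alpha>: "star_automorphism \<alpha>"
    and u: "unitary u" and cov: "\<And>a. u * \<iota> a * star u = \<iota> (\<alpha> a)"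
    and R: "tracial_rokhlin_property \<alpha>" and k: "k \<noteq> 0"
  shows "\<sigma> (\<iota> a * unitary_pow u k) = 0"
proof -
  have t: "\<sigma> \<circ> \<iota> \<in> tracial_states" by (rule tracial_state_comp_star_hom[OF s hom])
  have pos: "\<sigma> (\<iota> a * unitary_pow u (int n)) = 0" if n: "1 \<le> n" for n a
  proof -
    have small: "cmod (\<sigma> (\<iota> a * unitary_pow u (int n))) \<le> real n * norm a * sqrt (2 / (real N + 1))"
      if N: "n \<le> N" for N
    proof (rule field_le_epsilon)
      fix \<epsilon> :: real assume \<epsilon>: "0 < \<epsilon>"
      define C where "C = norm a * real n + 1"
      have C: "C > 0" by (simp add: C_def add_nonneg_pos)
      \<comment> \<open>The first bound makes the contribution of the low levels at most \<epsilon>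
        / 2; the second is the hypothesis of the estimate.\<close>
      define \<eta> where "\<eta> = min (\<epsilon> / 2 / ((real N + 1) * C)) (1 / (real N + 1)\<^sup>2)"
      have \<eta>: "0 < \<eta>" "\<eta> \<le> 1 / (real N + 1)\<^sup>2" "\<eta> \<le> \<epsilon> / 2 / ((real N + 1) * C)"
        using \<epsilon> C by (auto simp: \<eta>_def)
      have "(real N + 1) * (C * \<eta>) \<le> \<epsilon> / 2"
        using \<eta>(3) C by (simp add: pos_le_divide_eq mult_ac)
      \<comment> \<open>Chosen so that \<open>(norm a + 1) * sqrt \<delta>\<close> is \<epsilon> /
        2; the 1 is added because \<open>a\<close> may be 0.\<close>
      define \<delta> where "\<delta> = (\<epsilon> / (2 * (norm a + 1)))\<^sup>2"
      have a1: "norm a + 1 > 0" by (simp add: add_nonneg_pos)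
      have "\<delta> > 0" using \<epsilon> a1 by (simp add: \<delta>_def)
      then obtain p where p: "projection p" "p \<noteq> 0" "Re (\<sigma> (\<iota> p)) < \<delta>"
        using exists_small_projection[OF sf nd \<alpha> R t] by auto
      have "sqrt (Re (\<sigma> (\<iota> p))) \<le> \<epsilon> / (2 * (norm a + 1))"
        using p(3) \<epsilon> a1 unfolding \<delta>_def by (intro real_le_lsqrt) auto
      then have "norm a * sqrt (Re (\<sigma> (\<iota> p))) \<le> (norm a + 1) * (\<epsilon> / (2 * (norm a + 1)))"
        using \<epsilon> a1 trace_projection[OF t p(1)] by (intro mult_mono) auto
      also have "\<dots> = \<epsilon> / 2"
        using nonzero_mult_divide_mult_cancel_left[of "norm a + 1" \<epsilon> 2] a1 by (simp add: mult.commute)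
      finally show "cmod (\<sigma> (\<iota> a * unitary_pow u (int n)))
          \<le> real n * norm a * sqrt (2 / (real N + 1)) + \<epsilon>"
        using trace_unitary_pow_estimate[OF s hom \<alpha> u cov R \<eta>(1,2) n N p(1,2), of a]
          \<open>(real N + 1) * (C * \<eta>) \<le> \<epsilon> / 2\<close>
        by (simp add: C_def mult.assoc)
    qed
    have "(\<lambda>N. 2 / (real N + 1)) \<longlonglongrightarrow> 0"
      using LIMSEQ_Suc[OF lim_const_over_n[of "2::real"]] by (simp add: add.commute)
    then have "(\<lambda>N. real n * norm a * sqrt (2 / (real N + 1))) \<longlonglongrightarrow> real n * norm a * sqrt 0"
      by (intro tendsto_intros)
    then have "cmod (\<sigma> (\<iota> a * unitary_pow u (int n))) \<le> real n * norm a * sqrt 0"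
      by (rule tendsto_lowerbound) (auto intro!: eventually_sequentiallyI[of n] small)
    then show ?thesis by simp
  qed
  show ?thesis
  proof (cases "0 < k")
    case True
    then show ?thesis using pos[of "nat k" a] by simp
  next
    case False
    \<comment> \<open>The adjoint turns the negative power k into the positive power - k, and the
      trace property puts the coefficient back in front.\<close>
    have "\<sigma> (\<iota> a * unitary_pow u k) = cnj (\<sigma> (star (\<iota> a * unitary_pow u k)))"
      by (simp add: tracial_state_star[OF s])
    also have "star (\<iota> a * unitary_pow u k) = unitary_pow u (- k) * \<iota> (star a)"
      by (simp add: star_mult star_unitary_pow star_hom_simps(4)[OF hom])
    also have "\<sigma> \<dots> = \<sigma> (\<iota> (star a) * unitary_pow u (- k))" by (rule tracial_statesD(5)[OF s])
    also have "\<dots> = 0" using pos[of "nat (- k)" "star a"] False k by simp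
    finally show ?thesis by simp
  qed
qed

section \<open>The algebraic crossed product\<close>

text \<open>For double sums: the range S is one set for all k, containing the shift of T by k, so
  the sums can be swapped before n = l + k is substituted.\<close>

lemma sum_shift_support:
  fixes F :: "int \<Rightarrow> 'c::comm_monoid_add"
  assumes "finite S" "(+) k ` T \<subseteq> S" "\<And>l. l \<notin> T \<Longrightarrow> F l = 0"
  shows "(\<Sum>n\<in>S. F (n - k)) = (\<Sum>l\<in>T. F l)"
proof -
  have "(\<Sum>n\<in>S. F (n - k)) = (\<Sum>n\<in>(+) k ` T. F (n - k))"
  proof (rule sum.mono_neutral_right[OF assms(1,2)], intro ballI)
    fix n assume "n \<in> S - (+) k ` T"
    then have "n - k \<notin> T" using image_eqI[of n "(+) k" "n - k" T] by auto
    then show "F (n - k) = 0" by (rule assms(3))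
  qed
  also have "\<dots> = (\<Sum>l\<in>T. F l)" by (subst sum.reindex) auto
  finally show ?thesis .
qed

lemma finsupp_subset: "finite S \<Longrightarrow> {n. f n \<noteq> 0} \<subseteq> S \<Longrightarrow> f \<in> finsupp"
  unfolding finsupp_def by (auto intro: finite_subset)

lemma finsupp_add: "f \<in> finsupp \<Longrightarrow> g \<in> finsupp \<Longrightarrow> (\<lambda>n. f n + g n) \<in> finsupp"
  by (rule finsupp_subset[of "{n. f n \<noteq> 0} \<union> {n. g n \<noteq> 0}"]) (auto simp: finsupp_def)

lemma finsupp_scaleC: "f \<in> finsupp \<Longrightarrow> (\<lambda>n. c *\<^sub>C f n) \<in> finsupp"
  by (rule finsupp_subset[of "{n. f n \<noteq> 0}"]) (auto simp: finsupp_def)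

lemma finsupp_single: "(\<lambda>n. if n = k then a else 0) \<in> finsupp"
  by (rule finsupp_subset[of "{k}"]) auto

text \<open>Sums over supports change their index set with the function; any finite superset serves
  as a common one.\<close>

lemma conv_eq_sum:
  assumes "finite S" "{k. f k \<noteq> 0} \<subseteq> S"
  shows "conv \<alpha> f g n = (\<Sum>k\<in>S. f k * aut_pow \<alpha> k (g (n - k)))"
  unfolding conv_def using assms by (intro sum.mono_neutral_left) auto

lemma integrated_form_eq_sum:
  assumes "star_hom \<iota>" "finite S" "{k. f k \<noteq> 0} \<subseteq> S"
  shows "integrated_form \<iota> u f = (\<Sum>n\<in>S. \<iota> (f n) * unitary_pow u n)"
  unfolding integrated_form_def using assms
  by (intro sum.mono_neutral_left) (auto simp: star_hom_zero)

lemma conv_add_left: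
  assumes "f \<in> finsupp" "g \<in> finsupp"
  shows "conv \<alpha> (\<lambda>n. f n + g n) h = (\<lambda>n. conv \<alpha> f h n + conv \<alpha> g h n)"
proof
  fix n
  let ?S = "{k. f k \<noteq> 0} \<union> {k. g k \<noteq> 0}"
  have S: "finite ?S" using assms by (simp add: finsupp_def)
  show "conv \<alpha> (\<lambda>n. f n + g n) h n = conv \<alpha> f h n + conv \<alpha> g h n"
    by (subst (1 2 3) conv_eq_sum[OF S]) (auto simp: distrib_right sum.distrib)
qed

lemma conv_scaleC_left:
  assumes "f \<in> finsupp"
  shows "conv \<alpha> (\<lambda>n. c *\<^sub>C f n) h = (\<lambda>n. c *\<^sub>C conv \<alpha> f h n)"
proof
  fix n
  let ?S = "{k. f k \<noteq> 0}"
  have S: "finite ?S" using assms by (simp add: finsupp_def)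
  show "conv \<alpha> (\<lambda>n. c *\<^sub>C f n) h n = c *\<^sub>C conv \<alpha> f h n"
    by (subst (1 2) conv_eq_sum[OF S]) (auto simp: mult_scaleC_left scaleC_sum_right)
qed

context
  fixes \<alpha> :: "'a::unital_cstar_algebra \<Rightarrow> 'a"
  assumes aut: "star_automorphism \<alpha>"
begin

lemma bij_aut: "bij \<alpha>"
  using aut by (simp add: star_automorphism_def)

lemmas aut_pow_hom = star_hom_aut_pow[OF aut]

lemma aut_pow_cancel: "aut_pow \<alpha> k (aut_pow \<alpha> (- k) a) = a" "aut_pow \<alpha> (- k) (aut_pow \<alpha> k a) = a"
  using aut_pow_add[OF bij_aut, of k "- k" a] aut_pow_add[OF bij_aut, of "- k" k a] by simp_all

lemma conv_nonzeroD:
  assumes "conv \<alpha> f g n \<noteq> 0"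
  shows "\<exists>k. f k \<noteq> 0 \<and> g (n - k) \<noteq> 0"
proof (rule ccontr)
  assume "\<not> ?thesis"
  then have "f k * aut_pow \<alpha> k (g (n - k)) = 0" if "f k \<noteq> 0" for k
    using that star_hom_zero[OF aut_pow_hom] by auto
  then show False using assms unfolding conv_def by (simp add: sum.neutral)
qed

lemma conv_support:
  "{n. conv \<alpha> f g n \<noteq> 0} \<subseteq> (\<lambda>(k, l). k + l) ` ({k. f k \<noteq> 0} \<times> {l. g l \<noteq> 0})"
proof
  fix n assume "n \<in> {n. conv \<alpha> f g n \<noteq> 0}"
  then obtain k where "f k \<noteq> 0" "g (n - k) \<noteq> 0" using conv_nonzeroD by blast
  then show "n \<in> (\<lambda>(k, l). k + l) ` ({k. f k \<noteq> 0} \<times> {l. g l \<noteq> 0})"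
    by (intro image_eqI[of _ _ "(k, n - k)"]) auto
qed

lemma finsupp_conv: "f \<in> finsupp \<Longrightarrow> g \<in> finsupp \<Longrightarrow> conv \<alpha> f g \<in> finsupp"
  by (rule finsupp_subset[OF _ conv_support]) (auto simp: finsupp_def)

lemma conv_star_eq_0_iff: "conv_star \<alpha> f n = 0 \<longleftrightarrow> f (- n) = 0"
proof
  assume "conv_star \<alpha> f n = 0"
  then have "aut_pow \<alpha> (- n) (aut_pow \<alpha> n (star (f (- n)))) = 0"
    by (simp add: conv_star_def star_hom_zero[OF aut_pow_hom])
  then show "f (- n) = 0" by (simp add: aut_pow_cancel)
qed (simp add: conv_star_def star_hom_zero[OF aut_pow_hom])

lemma conv_star_support: "{n. conv_star \<alpha> f n \<noteq> 0} = uminus ` {n. f n \<noteq> 0}"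
proof -
  have "n \<in> uminus ` {n. f n \<noteq> 0}" if "f (- n) \<noteq> 0" for n
    using image_eqI[of n uminus "- n" "{n. f n \<noteq> 0}"] that by simp
  then show ?thesis by (auto simp: conv_star_eq_0_iff)
qed

lemma finsupp_conv_star: "f \<in> finsupp \<Longrightarrow> conv_star \<alpha> f \<in> finsupp"
  by (simp add: finsupp_def conv_star_support)

lemma conv_star_conv_star: "conv_star \<alpha> (conv_star \<alpha> f) = f"
proof
  fix n
  show "conv_star \<alpha> (conv_star \<alpha> f) n = f n"
    unfolding conv_star_def
    by (simp add: star_star aut_pow_cancel flip: star_hom_simps(4)[OF aut_pow_hom])
qed

text \<open>Collects both factors under one power of \<alpha>, which an invariant trace then
  removes.\<close>

lemma conv_conv_star:
  "conv \<alpha> (conv_star \<alpha> f) h m = (\<Sum>k | f k \<noteq> 0. aut_pow \<alpha> (- k) (star (f k) * h (m + k)))"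
  unfolding conv_def conv_star_support
  by (subst sum.reindex) (auto simp: conv_star_def star_hom_simps(3)[OF aut_pow_hom])

lemma conv_assoc:
  assumes "f \<in> finsupp" "g \<in> finsupp"
  shows "conv \<alpha> (conv \<alpha> f g) h = conv \<alpha> f (conv \<alpha> g h)"
proof
  fix n
  let ?F = "{k. f k \<noteq> 0}" and ?G = "{k. g k \<noteq> 0}"
  let ?S = "(\<lambda>(k, l). k + l) ` (?F \<times> ?G)"
  have fin: "finite ?S" using assms by (simp add: finsupp_def)
  have "conv \<alpha> (conv \<alpha> f g) h n = (\<Sum>m\<in>?S. conv \<alpha> f g m * aut_pow \<alpha> m (h (n - m)))"
    by (rule conv_eq_sum[OF fin conv_support])
  also have "\<dots> = (\<Sum>k\<in>?F. \<Sum>m\<in>?S. f k * aut_pow \<alpha> k (g (m - k)) * aut_pow \<alpha> m (h (n - m)))"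
    unfolding conv_def sum_distrib_right by (rule sum.swap)
  also have "\<dots> = (\<Sum>k\<in>?F. \<Sum>l\<in>?G. f k * aut_pow \<alpha> k (g l) * aut_pow \<alpha> (l + k) (h (n - (l + k))))"
  proof (rule sum.cong[OF refl])
    fix k assume k: "k \<in> ?F"
    have "(\<Sum>m\<in>?S. (\<lambda>l. f k * aut_pow \<alpha> k (g l) * aut_pow \<alpha> (l + k) (h (n - (l + k)))) (m - k))
        = (\<Sum>l\<in>?G. f k * aut_pow \<alpha> k (g l) * aut_pow \<alpha> (l + k) (h (n - (l + k))))"
      using fin k by (intro sum_shift_support) (auto simp: star_hom_zero[OF aut_pow_hom])
    then show "(\<Sum>m\<in>?S. f k * aut_pow \<alpha> k (g (m - k)) * aut_pow \<alpha> m (h (n - m)))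
        = (\<Sum>l\<in>?G. f k * aut_pow \<alpha> k (g l) * aut_pow \<alpha> (l + k) (h (n - (l + k))))" by simp
  qed
  also have "\<dots> = (\<Sum>k\<in>?F. f k * aut_pow \<alpha> k (\<Sum>l\<in>?G. g l * aut_pow \<alpha> l (h (n - k - l))))"
    by (simp add: star_hom_sum[OF aut_pow_hom] star_hom_simps(3)[OF aut_pow_hom] sum_distrib_left
        mult.assoc add.commute aut_pow_add[OF bij_aut] diff_diff_eq)
  finally show "conv \<alpha> (conv \<alpha> f g) h n = conv \<alpha> f (conv \<alpha> g h) n"
    unfolding conv_def .
qed

lemma conv_delta: "f \<in> finsupp \<Longrightarrow> conv \<alpha> f (\<lambda>n. if n = 0 then 1 else 0) = f"
proof
  fix n assume f: "f \<in> finsupp"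
  have "conv \<alpha> f (\<lambda>n. if n = 0 then 1 else 0) n = (\<Sum>k | f k \<noteq> 0. if k = n then f k else 0)"
    unfolding conv_def
    by (intro sum.cong) (auto simp: star_hom_zero[OF aut_pow_hom] star_hom_simps(5)[OF aut_pow_hom])
  then show "conv \<alpha> f (\<lambda>n. if n = 0 then 1 else 0) n = f n"
    using f by (simp add: finsupp_def)
qed

end

section \<open>The operator seminorm of an invariant trace\<close>

locale invariant_trace =
  fixes \<alpha> :: "'a::unital_cstar_algebra \<Rightarrow> 'a" and \<tau> :: "'a \<Rightarrow> complex"
  assumes aut: "star_automorphism \<alpha>" and trace: "\<tau> \<in> tracial_states"
    and invariant: "\<tau> (\<alpha> a) = \<tau> a"
begin

lemmas finsupp_intros [intro] = finsupp_add finsupp_scaleC finsupp_single finsupp_conv[OF aut]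
  finsupp_conv_star[OF aut]

lemma invariant_pow: "\<tau> (aut_pow \<alpha> k a) = \<tau> a"
  by (rule aut_pow_invariant[where \<tau> = \<tau>]) (rule bij_aut[OF aut], rule invariant)

lemma trace_norm_pow: "trace_norm \<tau> (aut_pow \<alpha> k a) = trace_norm \<tau> a"
  by (rule trace_norm_invariant[where \<tau> = \<tau>]) (rule aut_pow_hom[OF aut], rule invariant_pow)

text \<open>The semi-inner product of a direct sum of GNS spaces of \<tau>, one for each integer.
  For invariant \<tau> it is \<tau> of the coefficient at 0 of
  \<open>conv \<alpha> (conv_star \<alpha> f) g\<close>.\<close>

definition ip :: "(int \<Rightarrow> 'a) \<Rightarrow> (int \<Rightarrow> 'a) \<Rightarrow> complex" where
  "ip f g = (\<Sum>n | f n \<noteq> 0. \<tau> (star (f n) * g n))"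

definition hnorm :: "(int \<Rightarrow> 'a) \<Rightarrow> real" where
  "hnorm f = L2_set (\<lambda>n. trace_norm \<tau> (f n)) {n. f n \<noteq> 0}"

lemma ip_eq_sum:
  assumes "finite S" "{k. f k \<noteq> 0} \<subseteq> S"
  shows "ip f g = (\<Sum>n\<in>S. \<tau> (star (f n) * g n))"
  unfolding ip_def using assms
  by (intro sum.mono_neutral_left) (auto simp: tracial_state_zero[OF trace])

lemma hnorm_eq_L2:
  assumes "finite S" "{k. f k \<noteq> 0} \<subseteq> S"
  shows "hnorm f = L2_set (\<lambda>n. trace_norm \<tau> (f n)) S"
  unfolding hnorm_def L2_set_def using assms
  by (intro arg_cong[of _ _ sqrt] sum.mono_neutral_left)
    (auto simp: trace_norm_def tracial_state_zero[OF trace])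

lemma hnorm_nonneg [simp]: "0 \<le> hnorm f"
  by (simp add: hnorm_def)

lemma ip_self: "ip f f = of_real ((hnorm f)\<^sup>2)"
proof -
  have "\<tau> (star (f n) * f n) = of_real ((trace_norm \<tau> (f n))\<^sup>2)" for n
    by (simp add: trace_norm_power2[OF trace] complex_eq_iff tracial_state_square[OF trace])
  then show ?thesis
    by (simp add: ip_def hnorm_def L2_set_def sum_nonneg)
qed

lemma ip_Cauchy_Schwarz:
  assumes "f \<in> finsupp" "g \<in> finsupp"
  shows "cmod (ip f g) \<le> hnorm f * hnorm g"
proof -
  let ?S = "{k. f k \<noteq> 0} \<union> {k. g k \<noteq> 0}"
  have S: "finite ?S" using assms by (simp add: finsupp_def)
  have "cmod (ip f g) \<le> (\<Sum>n\<in>?S. cmod (\<tau> (star (f n) * g n)))"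
    by (subst ip_eq_sum[OF S]) (auto intro: norm_sum)
  also have "\<dots> \<le> (\<Sum>n\<in>?S. \<bar>trace_norm \<tau> (f n)\<bar> * \<bar>trace_norm \<tau> (g n)\<bar>)"
    using trace_Cauchy_Schwarz[OF trace] trace by (intro sum_mono) simp
  also have "\<dots> \<le> hnorm f * hnorm g"
    by (subst (1 2) hnorm_eq_L2[OF S]) (auto intro: L2_set_mult_ineq)
  finally show ?thesis .
qed

lemma hnorm_triangle:
  assumes "f \<in> finsupp" "g \<in> finsupp"
  shows "hnorm (\<lambda>n. f n + g n) \<le> hnorm f + hnorm g"
proof -
  let ?S = "{k. f k \<noteq> 0} \<union> {k. g k \<noteq> 0}"
  have S: "finite ?S" using assms by (simp add: finsupp_def)
  have "hnorm (\<lambda>n. f n + g n) = L2_set (\<lambda>n. trace_norm \<tau> (f n + g n)) ?S"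
    by (rule hnorm_eq_L2[OF S]) auto
  also have "\<dots> \<le> L2_set (\<lambda>n. trace_norm \<tau> (f n) + trace_norm \<tau> (g n)) ?S"
    using trace_norm_triangle[OF trace] trace by (intro L2_set_mono) auto
  also have "\<dots> \<le> L2_set (\<lambda>n. trace_norm \<tau> (f n)) ?S + L2_set (\<lambda>n. trace_norm \<tau> (g n)) ?S"
    by (rule L2_set_triangle_ineq)
  also have "\<dots> = hnorm f + hnorm g"
    by (subst (1 2) hnorm_eq_L2[OF S]) auto
  finally show ?thesis .
qed

lemma hnorm_scaleC:
  assumes "f \<in> finsupp"
  shows "hnorm (\<lambda>n. c *\<^sub>C f n) = cmod c * hnorm f"
proof -
  let ?S = "{k. f k \<noteq> 0}"
  have S: "finite ?S" using assms by (simp add: finsupp_def)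
  have "trace_norm \<tau> (c *\<^sub>C x) = cmod c * trace_norm \<tau> x" for x
  proof -
    have "star (c *\<^sub>C x) * (c *\<^sub>C x) = (cmod c)\<^sup>2 *\<^sub>R (star x * x)"
      by (simp add: scaleR_scaleC star_scaleC mult_scaleC_left mult_scaleC_right scaleC_scaleC
          complex_norm_square mult.commute del: of_real_power)
    then show ?thesis
      by (simp add: trace_norm_def tracial_state_scaleR[OF trace] real_sqrt_mult flip: of_real_power)
  qed
  then have "hnorm (\<lambda>n. c *\<^sub>C f n) = L2_set (\<lambda>n. cmod c * trace_norm \<tau> (f n)) ?S"
    by (subst hnorm_eq_L2[OF S]) auto
  then show ?thesis by (simp add: hnorm_def L2_set_right_distrib)
qed

text \<open>Left multiplication by c u^k: the shift and the power of \<alpha> preserve the seminorm,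
  and c contributes at most its norm.\<close>

lemma hnorm_translate:
  assumes g: "g \<in> finsupp"
  shows "hnorm (\<lambda>n. c * aut_pow \<alpha> k (g (n - k))) \<le> norm c * hnorm g"
proof -
  let ?S = "(+) k ` {n. g n \<noteq> 0}"
  have S: "finite ?S" using g by (simp add: finsupp_def)
  have "g (n - k) = 0" if "n \<notin> ?S" for n
    using that image_eqI[of n "(+) k" "n - k" "{n. g n \<noteq> 0}"] by auto
  then have "{n. c * aut_pow \<alpha> k (g (n - k)) \<noteq> 0} \<subseteq> ?S"
    using star_hom_zero[OF aut_pow_hom[OF aut]] by fastforce
  then have "hnorm (\<lambda>n. c * aut_pow \<alpha> k (g (n - k)))
      = L2_set (\<lambda>n. trace_norm \<tau> (c * aut_pow \<alpha> k (g (n - k)))) ?S"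
    by (rule hnorm_eq_L2[OF S])
  also have "\<dots> \<le> L2_set (\<lambda>n. norm c * trace_norm \<tau> (g (n - k))) ?S"
    by (intro L2_set_mono order.trans[OF trace_norm_mult_left[OF trace]]) (simp_all add: trace_norm_pow trace)
  also have "\<dots> = norm c * L2_set (\<lambda>n. trace_norm \<tau> (g (n - k))) ?S"
    by (simp add: L2_set_right_distrib)
  also have "L2_set (\<lambda>n. trace_norm \<tau> (g (n - k))) ?S = hnorm g"
    unfolding hnorm_def L2_set_def by (subst sum.reindex) auto
  finally show ?thesis .
qed

text \<open>The l1-norm of the coefficients is an operator bound; through it the infimum defining
  \<open>op_norm\<close> runs over a nonempty set.\<close>

lemma hnorm_conv_le:
  assumes f: "f \<in> finsupp" and g: "g \<in> finsupp"
  shows "hnorm (conv \<alpha> f g) \<le> (\<Sum>k | f k \<noteq> 0. norm (f k)) * hnorm g"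
proof -
  have tr: "(\<lambda>n. c * aut_pow \<alpha> k (g (n - k))) \<in> finsupp" for c k
  proof -
    have "(\<lambda>n. c * aut_pow \<alpha> k (g (n - k))) = conv \<alpha> (\<lambda>n. if n = k then c else 0) g"
      by (rule ext, subst conv_eq_sum[of "{k}"]) auto
    then show ?thesis using g by auto
  qed
  have "(\<lambda>n. \<Sum>k\<in>S. f k * aut_pow \<alpha> k (g (n - k))) \<in> finsupp \<and>
      hnorm (\<lambda>n. \<Sum>k\<in>S. f k * aut_pow \<alpha> k (g (n - k))) \<le> (\<Sum>k\<in>S. norm (f k)) * hnorm g"
    if "finite S" for S
    using that
  proof induction
    case empty
    show ?case by (simp add: finsupp_def hnorm_def)
  next
    case (insert k S)
    let ?h = "\<lambda>n. \<Sum>k\<in>S. f k * aut_pow \<alpha> k (g (n - k))"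
    have h: "?h \<in> finsupp" "hnorm ?h \<le> (\<Sum>k\<in>S. norm (f k)) * hnorm g"
      using insert.IH by blast+
    have "hnorm (\<lambda>n. f k * aut_pow \<alpha> k (g (n - k)) + ?h n)
        \<le> norm (f k) * hnorm g + (\<Sum>k\<in>S. norm (f k)) * hnorm g"
      using hnorm_triangle[OF tr h(1)] hnorm_translate[OF g] h(2) by (meson add_mono order.trans)
    then show ?case
      using finsupp_add[OF tr h(1)] insert.hyps by (simp add: distrib_right)
  qed
  then show ?thesis using f unfolding conv_def finsupp_def by blast
qed

text \<open>Left multiplication respects adjoints because \<tau> is invariant: the power of \<alpha>
  is pulled to the front of the argument of \<tau> and dropped.\<close>

lemma ip_conv_left:
  assumes "f \<in> finsupp" "g \<in> finsupp"
  shows "ip (conv \<alpha> f g) h = ip g (conv \<alpha> (conv_star \<alpha> f) h)"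
proof -
  let ?F = "{k. f k \<noteq> 0}" and ?G = "{k. g k \<noteq> 0}"
  let ?S = "(\<lambda>(k, l). k + l) ` (?F \<times> ?G)"
  note hom = star_hom_simps(1-4)[OF aut_pow_hom[OF aut]] star_hom_sum[OF aut_pow_hom[OF aut]]
    star_hom_zero[OF aut_pow_hom[OF aut]]
  have fin: "finite ?S" using assms by (simp add: finsupp_def)
  have "ip (conv \<alpha> f g) h = (\<Sum>n\<in>?S. \<tau> (star (conv \<alpha> f g n) * h n))"
    by (rule ip_eq_sum[OF fin conv_support[OF aut]])
  also have "\<dots> = (\<Sum>n\<in>?S. \<Sum>k\<in>?F. \<tau> (aut_pow \<alpha> k (star (g (n - k))) * (star (f k) * h n)))"
    by (simp add: conv_def star_sum star_mult sum_distrib_right tracial_state_sum[OF trace] hom(4)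
        mult.assoc)
  also have "\<dots> = (\<Sum>k\<in>?F. \<Sum>n\<in>?S. \<tau> (aut_pow \<alpha> k (star (g (n - k))) * (star (f k) * h n)))"
    by (rule sum.swap)
  also have "\<dots> = (\<Sum>k\<in>?F. \<Sum>l\<in>?G. \<tau> (aut_pow \<alpha> k (star (g l)) * (star (f k) * h (l + k))))"
  proof (rule sum.cong[OF refl])
    fix k assume k: "k \<in> ?F"
    have "(\<Sum>n\<in>?S. (\<lambda>l. \<tau> (aut_pow \<alpha> k (star (g l)) * (star (f k) * h (l + k)))) (n - k))
        = (\<Sum>l\<in>?G. \<tau> (aut_pow \<alpha> k (star (g l)) * (star (f k) * h (l + k))))"
      using fin k by (intro sum_shift_support) (auto simp: hom tracial_state_zero[OF trace])
    then show "(\<Sum>n\<in>?S. \<tau> (aut_pow \<alpha> k (star (g (n - k))) * (star (f k) * h n)))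
        = (\<Sum>l\<in>?G. \<tau> (aut_pow \<alpha> k (star (g l)) * (star (f k) * h (l + k))))" by simp
  qed
  also have "\<dots> = (\<Sum>k\<in>?F. \<Sum>l\<in>?G. \<tau> (star (g l) * aut_pow \<alpha> (- k) (star (f k) * h (l + k))))"
  proof (intro sum.cong refl)
    fix k l
    have "\<tau> (aut_pow \<alpha> k (star (g l)) * (star (f k) * h (l + k)))
      = \<tau> (aut_pow \<alpha> k (star (g l) * aut_pow \<alpha> (- k) (star (f k) * h (l + k))))"
      by (simp only: hom(3) aut_pow_cancel[OF aut])
    then show "\<tau> (aut_pow \<alpha> k (star (g l)) * (star (f k) * h (l + k)))
      = \<tau> (star (g l) * aut_pow \<alpha> (- k) (star (f k) * h (l + k)))" by (simp only: invariant_pow)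
  qed
  also have "\<dots> = (\<Sum>l\<in>?G. \<Sum>k\<in>?F. \<tau> (star (g l) * aut_pow \<alpha> (- k) (star (f k) * h (l + k))))"
    by (rule sum.swap)
  also have "\<dots> = ip g (conv \<alpha> (conv_star \<alpha> f) h)"
    by (simp add: ip_def conv_conv_star[OF aut] sum_distrib_left tracial_state_sum[OF trace])
  finally show ?thesis .
qed

text \<open>The identity behind positivity of the extended trace: on \<open>star b * b\<close>, with
  b the integrated form of f, its value is \<open>ip f f\<close>.\<close>

lemma trace_conv_conv_star: "\<tau> (conv \<alpha> (conv_star \<alpha> f) g 0) = ip f g"
  by (simp add: conv_conv_star[OF aut] ip_def tracial_state_sum[OF trace] invariant_pow)

text \<open>An infimum of bounds rather than a supremum of quotients, as \<open>hnorm\<close> may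
  vanish on nonzero functions.\<close>

definition op_norm :: "(int \<Rightarrow> 'a) \<Rightarrow> real" where
  "op_norm f = Inf {C. 0 \<le> C \<and> (\<forall>g\<in>finsupp. hnorm (conv \<alpha> f g) \<le> C * hnorm g)}"

lemma op_norm_le:
  assumes "0 \<le> C" "\<And>g. g \<in> finsupp \<Longrightarrow> hnorm (conv \<alpha> f g) \<le> C * hnorm g"
  shows "op_norm f \<le> C"
  unfolding op_norm_def using assms by (intro cInf_lower bdd_belowI[of _ 0]) auto

lemma op_norm_witness:
  assumes "f \<in> finsupp"
  shows "(\<Sum>k | f k \<noteq> 0. norm (f k)) \<in> {C. 0 \<le> C \<and> (\<forall>g\<in>finsupp. hnorm (conv \<alpha> f g) \<le> C * hnorm g)}"
  using hnorm_conv_le[OF assms] by (auto intro: sum_nonneg)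

lemma op_norm_nonneg: "f \<in> finsupp \<Longrightarrow> 0 \<le> op_norm f"
  unfolding op_norm_def using op_norm_witness by (intro cInf_greatest) auto

text \<open>The infimum is itself a bound. Dividing requires \<open>hnorm g\<close> to be nonzero;
  otherwise the l1 bound already gives 0.\<close>

lemma hnorm_conv_le_op_norm:
  assumes f: "f \<in> finsupp" and g: "g \<in> finsupp"
  shows "hnorm (conv \<alpha> f g) \<le> op_norm f * hnorm g"
proof (cases "hnorm g = 0")
  case True
  then show ?thesis using hnorm_conv_le[OF f g] by simp
next
  case False
  then have pos: "0 < hnorm g" using hnorm_nonneg[of g] by linarith
  have "hnorm (conv \<alpha> f g) / hnorm g \<le> op_norm f"
    unfolding op_norm_def
  proof (rule cInf_greatest)
    show "{C. 0 \<le> C \<and> (\<forall>g\<in>finsupp. hnorm (conv \<alpha> f g) \<le> C * hnorm g)} \<noteq> {}"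
      using op_norm_witness[OF f] by blast
  qed (use g pos in \<open>auto simp: pos_divide_le_eq\<close>)
  then show ?thesis using pos by (simp add: pos_divide_le_eq)
qed

text \<open>With k the image of g, the square of \<open>hnorm k\<close> is the inner product of g
  with \<open>conv \<alpha> f k\<close>; after Cauchy-Schwarz one factor \<open>hnorm k\<close>
  cancels.\<close>

lemma op_norm_conv_star_le:
  assumes f: "f \<in> finsupp"
  shows "op_norm (conv_star \<alpha> f) \<le> op_norm f"
proof (rule op_norm_le)
  fix g :: "int \<Rightarrow> 'a" assume g: "g \<in> finsupp"
  let ?k = "conv \<alpha> (conv_star \<alpha> f) g"
  have k: "?k \<in> finsupp" using f g by auto
  have "(hnorm ?k)\<^sup>2 = cmod (ip ?k ?k)" by (simp add: ip_self norm_power)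
  also have "\<dots> = cmod (ip g (conv \<alpha> f ?k))"
    using ip_conv_left[OF finsupp_conv_star[OF aut f] g, of ?k] by (simp add: conv_star_conv_star[OF aut])
  also have "\<dots> \<le> hnorm g * hnorm (conv \<alpha> f ?k)" using f g k by (intro ip_Cauchy_Schwarz) auto
  also have "\<dots> \<le> hnorm g * (op_norm f * hnorm ?k)"
    using hnorm_conv_le_op_norm[OF f k] by (intro mult_left_mono) auto
  finally have "hnorm ?k * hnorm ?k \<le> (op_norm f * hnorm g) * hnorm ?k"
    by (simp add: power2_eq_square mult_ac)
  then show "hnorm ?k \<le> op_norm f * hnorm g"
    using op_norm_nonneg[OF f] hnorm_nonneg[of ?k]
    by (cases "hnorm ?k = 0") (auto simp: mult_le_cancel_right)
qed (rule op_norm_nonneg[OF f])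

lemma op_norm_conv_le:
  assumes f: "f \<in> finsupp" and g: "g \<in> finsupp"
  shows "op_norm (conv \<alpha> f g) \<le> op_norm f * op_norm g"
proof (rule op_norm_le)
  show "0 \<le> op_norm f * op_norm g" using op_norm_nonneg f g by simp
  fix h :: "int \<Rightarrow> 'a" assume h: "h \<in> finsupp"
  have "hnorm (conv \<alpha> (conv \<alpha> f g) h) \<le> op_norm f * hnorm (conv \<alpha> g h)"
    unfolding conv_assoc[OF aut f g] using f g h by (intro hnorm_conv_le_op_norm) auto
  also have "\<dots> \<le> op_norm f * (op_norm g * hnorm h)"
    using op_norm_nonneg[OF f] hnorm_conv_le_op_norm[OF g h] by (rule mult_left_mono[rotated])
  finally show "hnorm (conv \<alpha> (conv \<alpha> f g) h) \<le> op_norm f * op_norm g * hnorm h"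
    by (simp add: mult.assoc)
qed

text \<open>One inequality is submultiplicativity with the bound for the adjoint. For the other, the
  square of \<open>hnorm (conv \<alpha> f g)\<close> is an inner product of g with its image under
  the product on the left, to which Cauchy-Schwarz applies.\<close>

lemma op_norm_conv_star_conv:
  assumes f: "f \<in> finsupp"
  shows "op_norm (conv \<alpha> (conv_star \<alpha> f) f) = (op_norm f)\<^sup>2"
proof (rule antisym)
  note fs = finsupp_conv_star[OF aut f]
  let ?N = "op_norm (conv \<alpha> (conv_star \<alpha> f) f)"
  have "?N \<le> op_norm (conv_star \<alpha> f) * op_norm f" by (rule op_norm_conv_le[OF fs f])
  also have "\<dots> \<le> op_norm f * op_norm f"
    using op_norm_conv_star_le[OF f] op_norm_nonneg[OF f] by (rule mult_right_mono)
  finally show "?N \<le> (op_norm f)\<^sup>2" by (simp add: power2_eq_square)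
  have N: "0 \<le> ?N" using fs f by (intro op_norm_nonneg) auto
  have "op_norm f \<le> sqrt ?N"
  proof (rule op_norm_le)
    fix g :: "int \<Rightarrow> 'a" assume g: "g \<in> finsupp"
    let ?k = "conv \<alpha> f g"
    have k: "?k \<in> finsupp" using f g by auto
    have "(hnorm ?k)\<^sup>2 = cmod (ip ?k ?k)" by (simp add: ip_self norm_power)
    also have "\<dots> = cmod (ip g (conv \<alpha> (conv \<alpha> (conv_star \<alpha> f) f) g))"
      by (simp add: ip_conv_left[OF f g] conv_assoc[OF aut fs f])
    also have "\<dots> \<le> hnorm g * hnorm (conv \<alpha> (conv \<alpha> (conv_star \<alpha> f) f) g)"
      using f g by (intro ip_Cauchy_Schwarz) auto
    also have "\<dots> \<le> hnorm g * (?N * hnorm g)"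
      using f g by (intro mult_left_mono hnorm_conv_le_op_norm) auto
    also have "\<dots> = (sqrt ?N * hnorm g)\<^sup>2"
      using N by (simp add: power_mult_distrib) (simp add: power2_eq_square)
    finally show "hnorm ?k \<le> sqrt ?N * hnorm g"
      by (rule power2_le_imp_le) (simp add: N)
  qed (simp add: N)
  then show "(op_norm f)\<^sup>2 \<le> ?N"
    using op_norm_nonneg[OF f] N using power_mono[of "op_norm f" "sqrt ?N" 2] by simp
qed

lemma op_norm_scaleC:
  assumes f: "f \<in> finsupp"
  shows "op_norm (\<lambda>n. c *\<^sub>C f n) = cmod c * op_norm f"
proof -
  have le: "op_norm (\<lambda>n. c *\<^sub>C f n) \<le> cmod c * op_norm f" if f: "f \<in> finsupp" for c f
  proof (rule op_norm_le)
    fix g :: "int \<Rightarrow> 'a" assume g: "g \<in> finsupp"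
    have "hnorm (conv \<alpha> (\<lambda>n. c *\<^sub>C f n) g) = cmod c * hnorm (conv \<alpha> f g)"
      using f g by (simp add: conv_scaleC_left hnorm_scaleC finsupp_conv[OF aut])
    also have "\<dots> \<le> cmod c * (op_norm f * hnorm g)"
      using hnorm_conv_le_op_norm[OF f g] by (intro mult_left_mono) auto
    finally show "hnorm (conv \<alpha> (\<lambda>n. c *\<^sub>C f n) g) \<le> cmod c * op_norm f * hnorm g"
      by (simp add: mult.assoc)
  qed (use op_norm_nonneg[OF f] in simp)
  show ?thesis
  proof (cases "c = 0")
    case True
    then show ?thesis using le[OF f, of c] op_norm_nonneg[OF finsupp_scaleC[OF f], of c] by simp
  next
    case False
    then have "op_norm f \<le> cmod (inverse c) * op_norm (\<lambda>n. c *\<^sub>C f n)"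
      using le[OF finsupp_scaleC[OF f], of "inverse c" c] by (simp add: scaleC_scaleC)
    then have "cmod c * op_norm f \<le> op_norm (\<lambda>n. c *\<^sub>C f n)"
      using False by (simp add: norm_inverse pos_le_divide_eq mult.commute flip: divide_inverse_commute)
    then show ?thesis using le[OF f, of c] by simp
  qed
qed

lemma op_norm_triangle:
  assumes f: "f \<in> finsupp" and g: "g \<in> finsupp"
  shows "op_norm (\<lambda>n. f n + g n) \<le> op_norm f + op_norm g"
proof (rule op_norm_le)
  show "0 \<le> op_norm f + op_norm g" using op_norm_nonneg f g by simp
  fix h :: "int \<Rightarrow> 'a" assume h: "h \<in> finsupp"
  have "hnorm (conv \<alpha> (\<lambda>n. f n + g n) h) \<le> hnorm (conv \<alpha> f h) + hnorm (conv \<alpha> g h)"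
    unfolding conv_add_left[OF f g] using f g h by (intro hnorm_triangle) auto
  also have "\<dots> \<le> op_norm f * hnorm h + op_norm g * hnorm h"
    using f g h by (intro add_mono hnorm_conv_le_op_norm)
  finally show "hnorm (conv \<alpha> (\<lambda>n. f n + g n) h) \<le> (op_norm f + op_norm g) * hnorm h"
    by (simp add: distrib_right)
qed

lemma cstar_seminorm_op_norm: "cstar_seminorm \<alpha> op_norm"
  unfolding cstar_seminorm_def
  by (intro conjI ballI allI op_norm_nonneg op_norm_triangle op_norm_scaleC op_norm_conv_le
      op_norm_conv_star_conv)

text \<open>Apply f to the unit vector supported at 0: the result is f itself, so
  \<open>hnorm f\<close> is at most \<open>op_norm f\<close>, and a single coefficient is dominated
  by \<open>hnorm f\<close>.\<close>

lemma cmod_trace_le_op_norm: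
  assumes f: "f \<in> finsupp"
  shows "cmod (\<tau> (f 0)) \<le> op_norm f"
proof -
  let ?d = "\<lambda>n::int. if n = 0 then 1 else 0 :: 'a"
  have "hnorm ?d = 1"
    by (subst hnorm_eq_L2[of "{0}"]) (auto simp: trace_norm_one[OF trace] L2_set_def)
  then have le: "hnorm f \<le> op_norm f"
    using hnorm_conv_le_op_norm[OF f finsupp_single, of 0 1] by (simp add: conv_delta[OF aut f])
  have "cmod (\<tau> (f 0)) \<le> trace_norm \<tau> (f 0)" by (rule cmod_trace_le[OF trace])
  also have "\<dots> \<le> L2_set (\<lambda>n. trace_norm \<tau> (f n)) ({n. f n \<noteq> 0} \<union> {0})"
    using f trace by (intro member_le_L2_set) (auto simp: finsupp_def)
  also have "\<dots> = hnorm f"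
    using f by (intro hnorm_eq_L2[symmetric]) (auto simp: finsupp_def)
  finally show ?thesis using le by simp
qed

text \<open>The term k of one convolution and the term - k of the other have the same trace, by the
  trace property and invariance.\<close>

lemma trace_conv_commute:
  assumes "f \<in> finsupp" "g \<in> finsupp"
  shows "\<tau> (conv \<alpha> f g 0) = \<tau> (conv \<alpha> g f 0)"
proof -
  \<comment> \<open>Contains the support of \<open>f\<close>, and its negative contains that of
    \<open>g\<close>.\<close>
  let ?S = "{k. f k \<noteq> 0} \<union> uminus ` {k. g k \<noteq> 0}"
  have S: "finite ?S" using assms by (simp add: finsupp_def)
  then have S': "finite (uminus ` ?S)" by simp
  have "\<tau> (f k * aut_pow \<alpha> k (g (- k))) = \<tau> (g (- k) * aut_pow \<alpha> (- k) (f k))" for k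
  proof -
    have "\<tau> (f k * aut_pow \<alpha> k (g (- k))) = \<tau> (aut_pow \<alpha> k (g (- k)) * f k)"
      by (rule tracial_statesD(5)[OF trace])
    also have "\<dots> = \<tau> (aut_pow \<alpha> k (g (- k) * aut_pow \<alpha> (- k) (f k)))"
      by (simp only: star_hom_simps(3)[OF aut_pow_hom[OF aut]] aut_pow_cancel[OF aut])
    finally show ?thesis by (simp only: invariant_pow)
  qed
  then have "\<tau> (conv \<alpha> f g 0) = (\<Sum>k\<in>?S. \<tau> (g (- k) * aut_pow \<alpha> (- k) (f k)))"
    by (subst conv_eq_sum[OF S]) (auto simp: tracial_state_sum[OF trace])
  also have "\<dots> = (\<Sum>k\<in>uminus ` ?S. \<tau> (g k * aut_pow \<alpha> k (f (0 - k))))"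
    by (subst sum.reindex) auto
  also have "\<dots> = \<tau> (conv \<alpha> g f 0)"
  proof -
    have "k \<in> uminus ` ?S" if "g k \<noteq> 0" for k
      using image_eqI[of k uminus "- k" ?S] that by simp
    then have "{k. g k \<noteq> 0} \<subseteq> uminus ` ?S" by blast
    then show ?thesis by (simp only: conv_eq_sum[OF S'] tracial_state_sum[OF trace])
  qed
  finally show ?thesis .
qed

end

section \<open>Extending an invariant trace to the crossed product\<close>

lemma tracial_state_tendsto:
  assumes "\<sigma> \<in> tracial_states" "x \<longlonglongrightarrow> l"
  shows "(\<lambda>i. \<sigma> (x i)) \<longlonglongrightarrow> \<sigma> l"
proof -
  have "(\<lambda>i. norm (x i - l)) \<longlonglongrightarrow> 0"
    using assms(2) by (simp add: tendsto_norm_zero LIM_zero)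
  then have "(\<lambda>i. \<sigma> (x i) - \<sigma> l) \<longlonglongrightarrow> 0"
    by (rule Lim_null_comparison[rotated])
      (simp add: cmod_trace_le_norm[OF assms(1)] flip: tracial_state_diff[OF assms(1)])
  then show ?thesis by (simp add: LIM_zero_iff)
qed

lemma integrated_form_add:
  assumes "star_hom \<iota>" "f \<in> finsupp" "g \<in> finsupp"
  shows "integrated_form \<iota> u (\<lambda>n. f n + g n) = integrated_form \<iota> u f + integrated_form \<iota> u g"
proof -
  let ?S = "{k. f k \<noteq> 0} \<union> {k. g k \<noteq> 0}"
  have S: "finite ?S" using assms by (simp add: finsupp_def)
  show ?thesis
    by (subst (1 2 3) integrated_form_eq_sum[OF assms(1) S])
      (auto simp: star_hom_simps(1)[OF assms(1)] distrib_right sum.distrib)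
qed

lemma integrated_form_scaleC:
  assumes "star_hom \<iota>" "f \<in> finsupp"
  shows "integrated_form \<iota> u (\<lambda>n. c *\<^sub>C f n) = c *\<^sub>C integrated_form \<iota> u f"
proof -
  let ?S = "{k. f k \<noteq> 0}"
  have S: "finite ?S" using assms by (simp add: finsupp_def)
  show ?thesis
    by (subst (1 2) integrated_form_eq_sum[OF assms(1) S])
      (auto simp: star_hom_simps(2)[OF assms(1)] mult_scaleC_left scaleC_sum_right)
qed

lemma integrated_form_single:
  assumes "star_hom \<iota>"
  shows "integrated_form \<iota> u (\<lambda>n. if n = 0 then a else 0) = \<iota> a"
  by (subst integrated_form_eq_sum[OF assms, of "{0}"]) auto

lemma integrated_form_conv:
  assumes hom: "star_hom \<iota>" and \<alpha>: "star_automorphism \<alpha>" and u: "unitary u"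
    and cov: "\<And>a. u * \<iota> a * star u = \<iota> (\<alpha> a)" and f: "f \<in> finsupp" and g: "g \<in> finsupp"
  shows "integrated_form \<iota> u (conv \<alpha> f g) = integrated_form \<iota> u f * integrated_form \<iota> u g"
proof -
  let ?F = "{k. f k \<noteq> 0}" and ?G = "{k. g k \<noteq> 0}"
  let ?S = "(\<lambda>(k, l). k + l) ` (?F \<times> ?G)"
  have fin: "finite ?S" using f g by (simp add: finsupp_def)
  have product: "\<iota> (f k) * unitary_pow u k * (\<iota> (g l) * unitary_pow u l)
      = \<iota> (f k * aut_pow \<alpha> k (g l)) * unitary_pow u (l + k)" for k l
  proof -
    have "\<iota> (f k) * unitary_pow u k * (\<iota> (g l) * unitary_pow u l)
        = \<iota> (f k) * (unitary_pow u k * \<iota> (g l)) * unitary_pow u l" by (simp only: mult.assoc)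
    also have "\<dots> = \<iota> (f k) * \<iota> (aut_pow \<alpha> k (g l)) * (unitary_pow u k * unitary_pow u l)"
      unfolding unitary_pow_covariant[of u \<alpha> \<iota>, OF u bij_aut[OF \<alpha>] cov] by (simp only: mult.assoc)
    finally show ?thesis
      by (simp only: star_hom_simps(3)[OF hom] unitary_pow_add[OF u, symmetric] add.commute)
  qed
  have "integrated_form \<iota> u (conv \<alpha> f g) = (\<Sum>n\<in>?S. \<iota> (conv \<alpha> f g n) * unitary_pow u n)"
    by (rule integrated_form_eq_sum[OF hom fin conv_support[OF \<alpha>]])
  also have "\<dots> = (\<Sum>k\<in>?F. \<Sum>n\<in>?S. \<iota> (f k * aut_pow \<alpha> k (g (n - k))) * unitary_pow u n)"
    unfolding conv_def star_hom_sum[OF hom] sum_distrib_right by (rule sum.swap)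
  also have "\<dots> = (\<Sum>k\<in>?F. \<Sum>l\<in>?G. \<iota> (f k * aut_pow \<alpha> k (g l)) * unitary_pow u (l + k))"
  proof (rule sum.cong[OF refl])
    fix k assume k: "k \<in> ?F"
    have "(\<Sum>n\<in>?S. (\<lambda>l. \<iota> (f k * aut_pow \<alpha> k (g l)) * unitary_pow u (l + k)) (n - k))
        = (\<Sum>l\<in>?G. \<iota> (f k * aut_pow \<alpha> k (g l)) * unitary_pow u (l + k))"
      using fin k
      by (intro sum_shift_support) (auto simp: star_hom_zero[OF aut_pow_hom[OF \<alpha>]] star_hom_zero[OF hom])
    then show "(\<Sum>n\<in>?S. \<iota> (f k * aut_pow \<alpha> k (g (n - k))) * unitary_pow u n)
        = (\<Sum>l\<in>?G. \<iota> (f k * aut_pow \<alpha> k (g l)) * unitary_pow u (l + k))" by simp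
  qed
  also have "\<dots> = integrated_form \<iota> u f * integrated_form \<iota> u g"
    unfolding integrated_form_def sum_product product ..
  finally show ?thesis .
qed

lemma integrated_form_conv_star:
  assumes hom: "star_hom \<iota>" and \<alpha>: "star_automorphism \<alpha>" and u: "unitary u"
    and cov: "\<And>a. u * \<iota> a * star u = \<iota> (\<alpha> a)"
  shows "integrated_form \<iota> u (conv_star \<alpha> f) = star (integrated_form \<iota> u f)"
proof -
  have "integrated_form \<iota> u (conv_star \<alpha> f)
      = (\<Sum>k | f k \<noteq> 0. \<iota> (aut_pow \<alpha> (- k) (star (f k))) * unitary_pow u (- k))"
    unfolding integrated_form_def conv_star_support[OF \<alpha>]
    by (subst sum.reindex) (auto simp: conv_star_def)
  then show ?thesis
    by (simp add: integrated_form_def star_sum star_mult star_unitary_pow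
        unitary_pow_covariant[of u \<alpha> \<iota>, OF u bij_aut[OF \<alpha>] cov] flip: star_hom_simps(4)[OF hom])
qed

lemma exists_trace_extension:
  assumes \<alpha>: "star_automorphism \<alpha>" and cp: "is_crossed_product \<alpha> \<iota> u"
    and \<tau>: "\<tau> \<in> tracial_states" and inv: "\<And>a. \<tau> (\<alpha> a) = \<tau> a"
  shows "\<exists>\<sigma>\<in>tracial_states. \<sigma> \<circ> \<iota> = \<tau>"
proof -
  interpret invariant_trace \<alpha> \<tau> by standard (fact \<alpha> \<tau> inv)+
  have hom: "star_hom \<iota>" and u: "unitary u" and cov: "\<And>a. u * \<iota> a * star u = \<iota> (\<alpha> a)"
    and dense: "closure (integrated_form \<iota> u ` finsupp) = UNIV"
    and max: "\<And>N f. cstar_seminorm \<alpha> N \<Longrightarrow> f \<in> finsupp \<Longrightarrow> N f \<le> norm (integrated_form \<iota> u f)"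
    using cp unfolding is_crossed_product_def by auto
  define \<pi> where "\<pi> = integrated_form \<iota> u"
  \<comment> \<open>Maximality of the crossed product norm, applied to the seminorm built from
    \<tau>.\<close>
  have bound: "cmod (\<tau> (f 0)) \<le> norm (\<pi> f)" if "f \<in> finsupp" for f
    using cmod_trace_le_op_norm[OF that] max[OF cstar_seminorm_op_norm that] unfolding \<pi>_def by linarith
  have lip: "cmod (\<tau> (f 0) - \<tau> (g 0)) \<le> norm (\<pi> f - \<pi> g)" if f: "f \<in> finsupp" and g: "g \<in> finsupp" for f g
  proof -
    have "\<pi> (\<lambda>n. f n + (- 1) *\<^sub>C g n) = \<pi> f - \<pi> g"
      unfolding \<pi>_def integrated_form_add[OF hom f finsupp_scaleC[OF g]] integrated_form_scaleC[OF hom g]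
      by (simp flip: minus_scaleC)
    then show ?thesis
      using bound[OF finsupp_add[OF f finsupp_scaleC[OF g, of "-1"]]]
      by (simp add: tracial_state_diff[OF \<tau>] flip: minus_scaleC)
  qed
  \<comment> \<open>The preimage is an arbitrary choice; \<open>lip\<close> makes the value
    independent of it.\<close>
  define \<sigma>0 where "\<sigma>0 b = \<tau> (inv_into finsupp \<pi> b 0)" for b
  have \<sigma>0: "\<sigma>0 (\<pi> f) = \<tau> (f 0)" if f: "f \<in> finsupp" for f
  proof -
    let ?g = "inv_into finsupp \<pi> (\<pi> f)"
    have "?g \<in> finsupp" "\<pi> ?g = \<pi> f" using f by (auto intro: inv_into_into f_inv_into_f[of "\<pi> f" \<pi>])
    then show ?thesis using lip[of ?g f] f by (simp add: \<sigma>0_def)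
  qed
  have "uniformly_continuous_on (\<pi> ` finsupp) \<sigma>0"
    unfolding uniformly_continuous_on_def dist_norm
  proof (intro allI impI)
    fix e :: real assume "e > 0"
    then show "\<exists>d>0. \<forall>x\<in>\<pi> ` finsupp. \<forall>x'\<in>\<pi> ` finsupp. norm (x' - x) < d \<longrightarrow> norm (\<sigma>0 x' - \<sigma>0 x) < e"
      using lip \<sigma>0 by (intro exI[of _ e]) (force intro: order.strict_trans1)
  qed
  then obtain \<sigma> where \<sigma>: "uniformly_continuous_on (closure (\<pi> ` finsupp)) \<sigma>"
      "\<And>x. x \<in> \<pi> ` finsupp \<Longrightarrow> \<sigma>0 x = \<sigma> x"
    by (rule uniformly_continuous_on_extension_on_closure) blast
  have cont: "continuous_on UNIV \<sigma>"
    using uniformly_continuous_imp_continuous[OF \<sigma>(1)] dense by (simp add: \<pi>_def)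
  have \<sigma>_\<pi>: "\<sigma> (\<pi> f) = \<tau> (f 0)" if "f \<in> finsupp" for f
    using \<sigma>(2)[of "\<pi> f"] \<sigma>0[OF that] that by simp
  have \<sigma>_lim: "(\<lambda>i. \<sigma> (x i)) \<longlonglongrightarrow> \<sigma> l" if "x \<longlonglongrightarrow> l" for x l
    using continuous_on_tendsto_compose[OF cont that] by simp
  have seq: "\<exists>f. (\<forall>i. f i \<in> finsupp) \<and> (\<lambda>i. \<pi> (f i)) \<longlonglongrightarrow> x" for x
  proof -
    have "x \<in> closure (\<pi> ` finsupp)" using dense by (simp add: \<pi>_def)
    then obtain y where y: "\<And>i. y i \<in> \<pi> ` finsupp" "y \<longlonglongrightarrow> x" unfolding closure_sequential by blast
    then have "\<forall>i. \<exists>f\<in>finsupp. y i = \<pi> f" by blast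
    then obtain f where "\<And>i. f i \<in> finsupp" "\<And>i. y i = \<pi> (f i)" by metis
    moreover from this have "y = (\<lambda>i. \<pi> (f i))" by blast
    ultimately show ?thesis using y(2) by blast
  qed
  \<comment> \<open>Every clause except the value at 1 is checked on integrated forms and passes to
    limits by continuity of \<sigma>.\<close>
  have "\<sigma> \<in> tracial_states"
    unfolding tracial_states_def
  proof (intro CollectI conjI allI impI)
    fix x y
    obtain f g where f: "\<And>i. f i \<in> finsupp" "(\<lambda>i. \<pi> (f i)) \<longlonglongrightarrow> x"
      and g: "\<And>i. g i \<in> finsupp" "(\<lambda>i. \<pi> (g i)) \<longlonglongrightarrow> y" using seq[of x] seq[of y] by blast
    have add: "\<sigma> (\<pi> (f i) + \<pi> (g i)) = \<sigma> (\<pi> (f i)) + \<sigma> (\<pi> (g i))" for i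
      unfolding \<pi>_def integrated_form_add[OF hom f(1) g(1), symmetric]
      unfolding \<pi>_def[symmetric] \<sigma>_\<pi>[OF f(1)] \<sigma>_\<pi>[OF g(1)] \<sigma>_\<pi>[OF finsupp_add[OF f(1) g(1)]]
      by (rule tracial_statesD(1)[OF \<tau>])
    have "(\<lambda>i. \<sigma> (\<pi> (f i) + \<pi> (g i))) \<longlonglongrightarrow> \<sigma> (x + y)" by (rule \<sigma>_lim[OF tendsto_add[OF f(2) g(2)]])
    moreover have "(\<lambda>i. \<sigma> (\<pi> (f i) + \<pi> (g i))) \<longlonglongrightarrow> \<sigma> x + \<sigma> y"
      unfolding add by (rule tendsto_add[OF \<sigma>_lim[OF f(2)] \<sigma>_lim[OF g(2)]])
    ultimately show "\<sigma> (x + y) = \<sigma> x + \<sigma> y" by (rule LIMSEQ_unique)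
    have commute: "\<sigma> (\<pi> (f i) * \<pi> (g i)) = \<sigma> (\<pi> (g i) * \<pi> (f i))" for i
    proof -
      have "\<pi> (f i) * \<pi> (g i) = \<pi> (conv \<alpha> (f i) (g i))" "\<pi> (g i) * \<pi> (f i) = \<pi> (conv \<alpha> (g i) (f i))"
        unfolding \<pi>_def using integrated_form_conv[of \<iota> \<alpha> u, OF hom \<alpha> u cov] f(1) g(1) by simp_all
      then show ?thesis
        using f(1) g(1) trace_conv_commute by (simp add: \<sigma>_\<pi> finsupp_conv[OF \<alpha>])
    qed
    have "(\<lambda>i. \<sigma> (\<pi> (f i) * \<pi> (g i))) \<longlonglongrightarrow> \<sigma> (x * y)" by (rule \<sigma>_lim[OF tendsto_mult[OF f(2) g(2)]])
    moreover have "(\<lambda>i. \<sigma> (\<pi> (f i) * \<pi> (g i))) \<longlonglongrightarrow> \<sigma> (y * x)"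
      unfolding commute by (rule \<sigma>_lim[OF tendsto_mult[OF g(2) f(2)]])
    ultimately show "\<sigma> (x * y) = \<sigma> (y * x)" by (rule LIMSEQ_unique)
  next
    fix c x
    obtain f where f: "\<And>i. f i \<in> finsupp" "(\<lambda>i. \<pi> (f i)) \<longlonglongrightarrow> x" using seq[of x] by blast
    have scale: "\<sigma> (c *\<^sub>C \<pi> (f i)) = c * \<sigma> (\<pi> (f i))" for i
      unfolding \<pi>_def integrated_form_scaleC[OF hom f(1), symmetric]
      unfolding \<pi>_def[symmetric] \<sigma>_\<pi>[OF f(1)] \<sigma>_\<pi>[OF finsupp_scaleC[OF f(1)]]
      by (rule tracial_statesD(2)[OF \<tau>])
    have "bounded_linear (\<lambda>x::'b. c *\<^sub>C x)"
      by (rule bounded_linear_intro[of _ "cmod c"])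
        (auto simp: scaleC_add_right scaleR_scaleC scaleC_scaleC norm_scaleC mult.commute)
    then have "(\<lambda>i. \<sigma> (c *\<^sub>C \<pi> (f i))) \<longlonglongrightarrow> \<sigma> (c *\<^sub>C x)" by (rule \<sigma>_lim[OF bounded_linear.tendsto[OF _ f(2)]])
    moreover have "(\<lambda>i. \<sigma> (c *\<^sub>C \<pi> (f i))) \<longlonglongrightarrow> c * \<sigma> x"
      unfolding scale by (rule tendsto_mult[OF tendsto_const \<sigma>_lim[OF f(2)]])
    ultimately show "\<sigma> (c *\<^sub>C x) = c * \<sigma> x" by (rule LIMSEQ_unique)
  next
    fix x :: 'b assume "positive x"
    then obtain b where x: "x = star b * b" unfolding positive_def by blast
    obtain f where f: "\<And>i. f i \<in> finsupp" "(\<lambda>i. \<pi> (f i)) \<longlonglongrightarrow> b" using seq[of b] by blast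
    have "(\<lambda>i. \<sigma> (star (\<pi> (f i)) * \<pi> (f i))) \<longlonglongrightarrow> \<sigma> x"
      unfolding x by (rule \<sigma>_lim[OF tendsto_mult[OF bounded_linear.tendsto[OF bounded_linear_star f(2)] f(2)]])
    moreover have "\<sigma> (star (\<pi> (f i)) * \<pi> (f i)) \<in> \<real>\<^sub>\<ge>\<^sub>0" for i
    proof -
      have "star (\<pi> (f i)) * \<pi> (f i) = \<pi> (conv \<alpha> (conv_star \<alpha> (f i)) (f i))"
        unfolding \<pi>_def
        by (simp only: integrated_form_conv[of \<iota> \<alpha> u, OF hom \<alpha> u cov finsupp_conv_star[OF \<alpha> f(1)] f(1)]
            integrated_form_conv_star[of \<iota> \<alpha> u, OF hom \<alpha> u cov])
      then have "\<sigma> (star (\<pi> (f i)) * \<pi> (f i)) = ip (f i) (f i)"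
        using f(1) by (simp add: \<sigma>_\<pi> finsupp_conv[OF \<alpha>] finsupp_conv_star[OF \<alpha>] trace_conv_conv_star)
      then show ?thesis by (simp only: ip_self) simp
    qed
    ultimately show "\<sigma> x \<in> \<real>\<^sub>\<ge>\<^sub>0"
      by (rule closed_sequentially[OF closed_nonneg_Reals_complex, rotated])
  next
    show "\<sigma> 1 = 1"
      using \<sigma>_\<pi>[OF finsupp_single[of 0 1]] tracial_statesD(4)[OF \<tau>]
      unfolding \<pi>_def integrated_form_single[OF hom] by (simp add: star_hom_simps(5)[OF hom])
  qed
  moreover have "\<sigma> \<circ> \<iota> = \<tau>"
  proof
    fix a
    show "(\<sigma> \<circ> \<iota>) a = \<tau> a"
      using \<sigma>_\<pi>[OF finsupp_single[of 0 a]] unfolding \<pi>_def integrated_form_single[OF hom] by simp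
  qed
  ultimately show ?thesis by blast
qed

theorem corollary4p6:
  fixes \<alpha> :: "'a::unital_cstar_algebra \<Rightarrow> 'a"
    and \<iota> :: "'a \<Rightarrow> 'b::unital_cstar_algebra"
    and u :: 'b
  assumes "simple_algebra TYPE('a)"
    and "real_rank_zero TYPE('a)"
    and "order_determined_by_traces TYPE('a)"
    and "stably_finite TYPE('a)"
    and "\<not> one_dimensional TYPE('a)"
    and "star_automorphism \<alpha>"
    and "tracial_rokhlin_property \<alpha>"
    and "is_crossed_product \<alpha> \<iota> u"
  shows "bij_betw (\<lambda>\<tau>. \<tau> \<circ> \<iota>)
    (tracial_states :: ('b \<Rightarrow> complex) set)
    {\<tau> \<in> tracial_states. \<forall>a. \<tau> (\<alpha> a) = \<tau> a}"
proof -
  have hom: "star_hom \<iota>" and u: "unitary u" and cov: "\<And>a. u * \<iota> a * star u = \<iota> (\<alpha> a)"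
    and dense: "closure (integrated_form \<iota> u ` finsupp) = UNIV"
    using assms(8) unfolding is_crossed_product_def by auto
  \<comment> \<open>All terms with n \<noteq> 0 are killed, so on a dense subset \<sigma> depends
    only on its restriction.\<close>
  have form: "\<sigma> (integrated_form \<iota> u f) = \<sigma> (\<iota> (f 0))" if \<sigma>: "\<sigma> \<in> tracial_states" and f: "f \<in> finsupp"
    for \<sigma> :: "'b \<Rightarrow> complex" and f
  proof -
    \<comment> \<open>0 is inserted because \<open>f 0\<close> may vanish, which would leave 0 out
      of the support.\<close>
    let ?S = "insert 0 {n. f n \<noteq> 0}"
    have S: "finite ?S" using f by (simp add: finsupp_def)
    have "\<sigma> (integrated_form \<iota> u f) = (\<Sum>n\<in>?S. \<sigma> (\<iota> (f n) * unitary_pow u n))"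
      by (subst integrated_form_eq_sum[OF hom S]) (auto simp: tracial_state_sum[OF \<sigma>])
    also have "\<dots> = (\<Sum>n\<in>?S. if n = 0 then \<sigma> (\<iota> (f 0)) else 0)"
      using trace_unitary_pow_eq_0[of \<sigma> \<iota> \<alpha> u, OF assms(4,5) \<sigma> hom assms(6) u cov assms(7)]
      by (intro sum.cong) auto
    also have "\<dots> = \<sigma> (\<iota> (f 0))" using S by simp
    finally show ?thesis .
  qed
  show ?thesis
  proof (rule bij_betw_imageI)
    show "inj_on (\<lambda>\<tau>. \<tau> \<circ> \<iota>) (tracial_states :: ('b \<Rightarrow> complex) set)"
    proof (intro inj_onI ext)
      fix \<sigma> \<sigma>' :: "'b \<Rightarrow> complex" and x
      assume \<sigma>: "\<sigma> \<in> tracial_states" and \<sigma>': "\<sigma>' \<in> tracial_states" and eq: "\<sigma> \<circ> \<iota> = \<sigma>' \<circ> \<iota>"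
      have "x \<in> closure (integrated_form \<iota> u ` finsupp)" by (simp add: dense)
      then obtain y where y: "\<And>i. y i \<in> integrated_form \<iota> u ` finsupp" "y \<longlonglongrightarrow> x"
        unfolding closure_sequential by blast
      have "\<sigma> (y i) = \<sigma>' (y i)" for i
        using y(1)[of i] form[OF \<sigma>] form[OF \<sigma>'] fun_cong[OF eq] by auto
      then have "(\<lambda>i. \<sigma> (y i)) \<longlonglongrightarrow> \<sigma>' x" using tracial_state_tendsto[OF \<sigma>' y(2)] by simp
      then show "\<sigma> x = \<sigma>' x" using tracial_state_tendsto[OF \<sigma> y(2)] LIMSEQ_unique by blast
    qed
    have "\<sigma> \<circ> \<iota> \<in> {\<tau> \<in> tracial_states. \<forall>a. \<tau> (\<alpha> a) = \<tau> a}" if "\<sigma> \<in> tracial_states" for \<sigma> :: "'b \<Rightarrow> complex"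
      using tracial_state_comp_star_hom[OF that hom] trace_unitary_invariant[of \<sigma> u \<iota> \<alpha>, OF that u cov]
      by simp
    moreover have "\<tau> \<in> (\<lambda>\<sigma>. \<sigma> \<circ> \<iota>) ` tracial_states"
      if "\<tau> \<in> tracial_states" "\<forall>a. \<tau> (\<alpha> a) = \<tau> a" for \<tau>
      using exists_trace_extension[OF assms(6,8) that(1)] that(2) by blast
    ultimately show "(\<lambda>\<tau>. \<tau> \<circ> \<iota>) ` (tracial_states :: ('b \<Rightarrow> complex) set)
        = {\<tau> \<in> tracial_states. \<forall>a. \<tau> (\<alpha> a) = \<tau> a}"
      by blast
  qed
qed

end
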